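(* Let $$P=21X_1^4+24X_1^3X_2-36X_1^3+18X_1^2X_2^2-24X_1^2X_2+18X_1^2+12X_1X_2^3-12X_1X_2^2+30X_2^4\in\mathbb{R}[X_1,X_2],$$ and let $\triangle\subset\mathbb{R}^2$ be the standard simplex with vertices $v_0=(0,0)$, $v_1=(1,0)$, $v_2=(0,1)$. Then: (i) $P=m^{T}M_Pm$ with $m=(X_1,\,X_1^2,\,X_1X_2,\,X_2^2)^T$ and the positive definite matrix $$M_P=\begin{bmatrix}18&-18&-12&-6\\-18&21&12&0\\-12&12&18&6\\-6&0&6&30\end{bmatrix};$$ hence $P$ is a sum of squares, $P(0,0)=0$, and $P(x)>0$ for every $x\in\mathbb{R}^2\setminus\{(0,0)\}$. (ii) The nonzero Bernstein coefficients of $P$ of degree $4$ with respect to $\triangle$ are $b_{(2,2,0)}=3$, $b_{(1,2,1)}=1$, $b_{(1,1,2)}=-1$, $b_{(0,4,0)}=3$, $b_{(0,0,4)}=30$. Moreover, for all $\beta_0,\beta_1,\beta_2\ge 0$ with $\beta_0+\beta_1+\beta_2=1$ and $\beta_1>0$, and all $\rho\in[0,1)$, if $\tilde\triangle$ is the simplex with (ordered) vertices $\tilde v_0=v_0$, $\tilde v_1=\beta_0v_0+\beta_1v_1+\beta_2v_2$, $\tilde v_2=\rho v_0+(1-\rho)v_2$, then $$b_{(1,1,2)}(P,4,\tilde\triangle)=\beta_1(1-\rho)^2\,b_{(1,1,2)}(P,4,\triangle)=-\beta_1(1-\rho)^2<0.$$ Consequently every triangulation of $\triangle$ contains a simplex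 on which, for a suitable ordering of its vertices, the coefficient with index $(1,1,2)$ is negative. (iii) There exists no certificate of nonnegativity of $P$ on $\triangle$ in the simplicial Bernstein basis: there is no triangulation of $\triangle$ (including the trivial one, $\triangle$ itself) and no choice of degrees $d\ge 4$ such that on every simplex $S$ of the triangulation one has $b_\alpha(P,d,S)\ge 0$ for all $\alpha\in\mathbb{N}_0^3$ with $|\alpha|=d$. In particular, the multivariate Bernstein theorem (if a nonzero polynomial of degree $p$ is positive on a simplex, then for some $d\ge p$ all its Bernstein coefficients of degree $d$ with respect to that simplex are positive) cannot be extended to certificates of nonnegativity for nonnegative polynomials with zeros at isolated points.
   Context: For affinely independent points $w_0,w_1,w_2\in\mathbb{R}^2$ (an ordered list of vertices), the associated barycentric coordinates are the affine polynomials $\lambda_0,\lambda_1,\lambda_2\in\mathbb{R}[X_1,X_2]$ with $\lambda_0+\lambda_1+\lambda_2=1$ and $x=\lambda_0(x)w_0+\lambda_1(x)w_1+\lambda_2(x)w_2$ for all $x\in\mathbb{R}^2$. The simplex with vertices $w_0,w_1,w_2$ is $S=\{x\in\mathbb{R}^2:\lambda_i(x)\ge 0,\ i=0,1,2\}$. For $d\in\mathbb{N}_0$ and $\alpha=(\alpha_0,\alpha_1,\alpha_2)\in\mathbb{N}_0^3$ with $|\alpha|:=\alpha_0+\alpha_1+\alpha_2=d$, the Bernstein polynomial of degree $d$ on $S$ is $$\mathcal{B}^d_\alpha=\frac{d!}{\alpha_0!\,\alpha_1!\,\alpha_2!}\,\lambda_0^{\alpha_0}\lambda_1^{\alpha_1}\lambda_2^{\alpha_2}.$$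 Every polynomial $Q\in\mathbb{R}[X_1,X_2]$ of degree at most $d$ can be written uniquely as $Q=\sum_{|\alpha|=d}b_\alpha(Q,d,S)\,\mathcal{B}^d_\alpha$ with real numbers $b_\alpha(Q,d,S)$, called the Bernstein coefficients of $Q$ of degree $d$ with respect to $S$. The condition $b_\alpha(Q,d,S)\ge 0$ for all $\alpha$ with $|\alpha|=d$ is called a certificate of nonnegativity of $Q$ on $S$; the degree $d\ge\deg Q$ is arbitrary. If no certificate is available on a simplex in degree $\deg Q$, one may try to refine it by degree elevation (using a larger $d$) or by subdivision (replacing the simplex by the simplices of a triangulation of it, with a certificate on each of them). A triangulation of $\triangle$ is a subdivision of $\triangle$ into finitely many nondegenerate simplices (triangles). *)

theory Defs
  imports "HOL-Analysis.Analysis" "HOL-Computational_Algebra.Polynomial"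
begin

(* The ring R[X1,X2] is rendered as R[X1][X2]: the outer variable of a
   "real poly poly" is X2 and its coefficients are polynomials in X1. *)

type_synonym poly2 = "real poly poly"

definition X1 :: poly2 where "X1 = [:[:0, 1:]:]"
definition X2 :: poly2 where "X2 = [:0, 1:]"

definition const2 :: "real \<Rightarrow> poly2" where "const2 c = [:[:c:]:]"

definition eval2 :: "poly2 \<Rightarrow> real ^ 2 \<Rightarrow> real" where
  "eval2 p x = poly (poly p [:x $ 2:]) (x $ 1)"

lemma eval2_simps [simp]:
  "eval2 X1 x = x $ 1"
  "eval2 X2 x = x $ 2"
  "eval2 (const2 c) x = c"
  "eval2 (p + q) x = eval2 p x + eval2 q x"
  "eval2 (p * q) x = eval2 p x * eval2 q x"
  by (simp_all add: eval2_def X1_def X2_def const2_def)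

(* The total degree; the zero polynomial gets degree 0. *)
definition total_degree :: "poly2 \<Rightarrow> nat" where
  "total_degree p = Max (insert 0 {i + j | i j. coeff (coeff p j) i \<noteq> 0})"

lemma finite_support2: "finite {i + j | i j. coeff (coeff (p :: poly2) j) i \<noteq> 0}"
proof -
  let ?B = "SIGMA j:{..degree p}. {..degree (coeff p j)}"
  have "{i + j | i j. coeff (coeff p j) i \<noteq> 0} \<subseteq> (\<lambda>(j, i). i + j) ` ?B"
  proof safe
    fix i j assume "coeff (coeff p j) i \<noteq> 0"
    then have "j \<le> degree p" "i \<le> degree (coeff p j)"
      by (auto intro!: le_degree)
    then show "i + j \<in> (\<lambda>(j, i). i + j) ` ?B"
      by (intro image_eqI[of _ _ "(j, i)"]) auto
  qed
  then show ?thesis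
    by (rule finite_subset) auto
qed

(* An ordered list of three vertices (w0, w1, w2). *)
type_synonym vertices = "(real ^ 2) \<times> (real ^ 2) \<times> (real ^ 2)"

(* Distinctness is needed: affine_dependent only sees the set of vertices. *)
fun affinely_independent :: "vertices \<Rightarrow> bool" where
  "affinely_independent (w0, w1, w2) \<longleftrightarrow>
     distinct [w0, w1, w2] \<and> \<not> affine_dependent {w0, w1, w2}"

fun is_barycentric :: "vertices \<Rightarrow> poly2 \<times> poly2 \<times> poly2 \<Rightarrow> bool" where
  "is_barycentric (w0, w1, w2) (l0, l1, l2) \<longleftrightarrow>
     total_degree l0 \<le> 1 \<and> total_degree l1 \<le> 1 \<and> total_degree l2 \<le> 1 \<and>
     l0 + l1 + l2 = 1 \<and>
     (\<forall>x. x = eval2 l0 x *\<^sub>R w0 + eval2 l1 x *\<^sub>R w1 + eval2 l2 x *\<^sub>R w2)"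

definition barycentric :: "vertices \<Rightarrow> poly2 \<times> poly2 \<times> poly2" where
  "barycentric w = (THE l. is_barycentric w l)"

definition simplex_of :: "vertices \<Rightarrow> (real ^ 2) set" where
  "simplex_of w = (case barycentric w of (l0, l1, l2) \<Rightarrow>
     {x. eval2 l0 x \<ge> 0 \<and> eval2 l1 x \<ge> 0 \<and> eval2 l2 x \<ge> 0})"

type_synonym multi_index = "nat \<times> nat \<times> nat"

definition indices :: "nat \<Rightarrow> multi_index set" where
  "indices d = {(a0, a1, a2). a0 + a1 + a2 = d}"

fun bernstein_poly :: "vertices \<Rightarrow> nat \<Rightarrow> multi_index \<Rightarrow> poly2" where
  "bernstein_poly w d (a0, a1, a2) = (case barycentric w of (l0, l1, l2) \<Rightarrow>
     const2 (fact d / (fact a0 * fact a1 * fact a2)) * l0 ^ a0 * l1 ^ a1 * l2 ^ a2)"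

(* The coefficient family of Q in the Bernstein basis, extended by 0 to
   indices of the wrong total degree so that it is a unique function.
   Meaningful for affinely independent w and total_degree Q \<le> d. *)
definition bernstein_coeff :: "poly2 \<Rightarrow> nat \<Rightarrow> vertices \<Rightarrow> multi_index \<Rightarrow> real" where
  "bernstein_coeff Q d w = (THE b.
     (\<forall>\<alpha>. \<alpha> \<notin> indices d \<longrightarrow> b \<alpha> = 0) \<and>
     Q = (\<Sum>\<alpha>\<in>indices d. const2 (b \<alpha>) * bernstein_poly w d \<alpha>))"

definition nonneg_certificate :: "poly2 \<Rightarrow> nat \<Rightarrow> vertices \<Rightarrow> bool" where
  "nonneg_certificate Q d w \<longleftrightarrow> (\<forall>\<alpha>\<in>indices d. bernstein_coeff Q d w \<alpha> \<ge> 0)"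

(* Subdivision into finitely many nondegenerate triangles with disjoint
   interiors. Adjacent triangles need not meet in a common face, so the
   face-to-face triangulations are among these. *)
definition triangulates :: "(real ^ 2) set set \<Rightarrow> (real ^ 2) set \<Rightarrow> bool" where
  "triangulates \<T> S \<longleftrightarrow>
     finite \<T> \<and>
     (\<forall>T\<in>\<T>. \<exists>w. affinely_independent w \<and> T = simplex_of w) \<and>
     (\<forall>T\<in>\<T>. \<forall>T'\<in>\<T>. T \<noteq> T' \<longrightarrow> interior T \<inter> interior T' = {}) \<and>
     \<Union>\<T> = S"

(* A certificate on each triangle T of a triangulation, the degree deg T being
   chosen per triangle. Reordering the vertices of T only permutes the
   coefficients, so it does not matter in which order they are taken. *)
definition nonneg_certificate_on ::
  "poly2 \<Rightarrow> (real ^ 2) set set \<Rightarrow> ((real ^ 2) set \<Rightarrow> nat) \<Rightarrow> bool" where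
  "nonneg_certificate_on Q \<T> deg \<longleftrightarrow>
     (\<forall>T\<in>\<T>. \<exists>w. affinely_independent w \<and> T = simplex_of w \<and>
        nonneg_certificate Q (deg T) w)"

definition positive_definite :: "real ^ 'n ^ 'n \<Rightarrow> bool" where
  "positive_definite A \<longleftrightarrow> transpose A = A \<and> (\<forall>x. x \<noteq> 0 \<longrightarrow> x \<bullet> (A *v x) > 0)"

definition v0 :: "real ^ 2" where "v0 = vector [0, 0]"
definition v1 :: "real ^ 2" where "v1 = vector [1, 0]"
definition v2 :: "real ^ 2" where "v2 = vector [0, 1]"

definition polyP :: poly2 where
  "polyP = 21 * X1 ^ 4 + 24 * X1 ^ 3 * X2 - 36 * X1 ^ 3 + 18 * X1 ^ 2 * X2 ^ 2
     - 24 * X1 ^ 2 * X2 + 18 * X1 ^ 2 + 12 * X1 * X2 ^ 3 - 12 * X1 * X2 ^ 2 + 30 * X2 ^ 4"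

definition M\<^sub>P :: "real ^ 4 ^ 4" where
  "M\<^sub>P = vector [
     vector [ 18, -18, -12, -6],
     vector [-18,  21,  12,  0],
     vector [-12,  12,  18,  6],
     vector [ -6,   0,   6, 30]]"

definition monomials :: "poly2 ^ 4" where
  "monomials = vector [X1, X1 ^ 2, X1 * X2, X2 ^ 2]"

end

theory Submission
  imports Defs
begin

text \<open>In every triangulation of the standard triangle, some triangle has vertices \<open>0\<close>, \<open>w\<^sub>1 = (p, q)\<close>
  and \<open>w\<^sub>2 = (0, s)\<close> with \<open>p, s > 0\<close>: infinitely many of the points \<open>(0, 1/n)\<close> lie in one of its
  finitely many triangles. Substituting \<open>X\<^sub>1 = p \<lambda>\<^sub>1\<close>, \<open>X\<^sub>2 = q \<lambda>\<^sub>1 + s \<lambda>\<^sub>2\<close> and homogenizing \<open>P\<close> by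
  \<open>\<lambda>\<^sub>0 + \<lambda>\<^sub>1 + \<lambda>\<^sub>2\<close>, every monomial is divisible by \<open>\<lambda>\<^sub>1\<^sup>2\<close> or \<open>\<lambda>\<^sub>2\<^sup>3\<close>, except \<open>- 12 p s\<^sup>2 \<lambda>\<^sub>0 \<lambda>\<^sub>1 \<lambda>\<^sub>2\<^sup>2\<close>.
  Elevating the degree to \<open>d\<close> multiplies by \<open>(\<lambda>\<^sub>0 + \<lambda>\<^sub>1 + \<lambda>\<^sub>2)\<^bsup>d - 4\<^esup>\<close>, so the coefficient of
  \<open>\<lambda>\<^sub>0\<^bsup>d - 3\<^esup> \<lambda>\<^sub>1 \<lambda>\<^sub>2\<^sup>2\<close> stays \<open>- 12 p s\<^sup>2 < 0\<close> in every degree.\<close>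

subsection \<open>Bivariate polynomials and barycentric coordinates\<close>

lemma eval2_more_simps [simp]:
  "eval2 0 x = 0" "eval2 1 x = 1" "eval2 (numeral n) x = numeral n"
  "eval2 (p - q) x = eval2 p x - eval2 q x" "eval2 (- p) x = - eval2 p x"
  "eval2 (p ^ k) x = eval2 p x ^ k" "eval2 (sum f A) x = (\<Sum>a\<in>A. eval2 (f a) x)"
  by (simp_all add: eval2_def poly_sum)

lemma const2_simps [simp]:
  "const2 0 = 0" "const2 1 = 1" "const2 (numeral n) = numeral n"
  "const2 (a + b) = const2 a + const2 b" "const2 (- a) = - const2 a"
  "const2 (a - b) = const2 a - const2 b" "const2 (a * b) = const2 a * const2 b"
  by (simp_all add: const2_def one_pCons numeral_poly)

text \<open>The infinitely-many-roots argument runs twice: for each \<open>v > 0\<close> the inner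
  polynomial has all positive reals as roots, and then the outer polynomial has all these constants
  \<open>[:v:]\<close> as roots. Points of the open quadrant suffice, which later keeps the
  denominator \<open>1 + x $ 1 + x $ 2\<close> nonzero.\<close>

lemma eq_zero_if_eval2_eq_zero:
  assumes "\<And>x. x $ 1 > 0 \<Longrightarrow> x $ 2 > 0 \<Longrightarrow> eval2 p x = 0"
  shows "p = 0"
proof -
  have "poly p [:v:] = 0" if "v > 0" for v
  proof -
    have "poly (poly p [:v:]) u = 0" if "u > 0" for u
      using assms[of "vector [u, v]"] \<open>u > 0\<close> \<open>v > 0\<close> by (simp add: eval2_def)
    then have "{0<..} \<subseteq> {u. poly (poly p [:v:]) u = 0}" by auto
    then show ?thesis
      using poly_roots_finite[of "poly p [:v:]"] infinite_Ioi[of "0 :: real"] finite_subset by blast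
  qed
  then have "(\<lambda>v. [:v:]) ` {0<..} \<subseteq> {q. poly p q = 0}" by auto
  moreover have "infinite ((\<lambda>v. [:v :: real:]) ` {0<..})"
    using infinite_Ioi[of "0 :: real"] by (subst finite_image_iff) (auto simp: inj_on_def)
  ultimately show ?thesis
    using poly_roots_finite[of p] finite_subset by blast
qed

lemma poly2_eqI:
  assumes "\<And>x. x $ 1 > 0 \<Longrightarrow> x $ 2 > 0 \<Longrightarrow> eval2 p x = eval2 q x"
  shows "p = q"
  using eq_zero_if_eval2_eq_zero[of "p - q"] assms by simp

lemma vec2_eq_iff: "x = y \<longleftrightarrow> x $ 1 = y $ 1 \<and> x $ 2 = y $ 2" for x y :: "'a ^ 2"
  by (simp add: vec_eq_iff forall_2)

lemma vector_4 [simp]: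
  "(vector [a, b, c, d] :: 'a::zero ^ 4) $ 1 = a" "(vector [a, b, c, d] :: 'a::zero ^ 4) $ 2 = b"
  "(vector [a, b, c, d] :: 'a::zero ^ 4) $ 3 = c" "(vector [a, b, c, d] :: 'a::zero ^ 4) $ 4 = d"
  unfolding vector_def by simp_all

lemma total_degree_le:
  assumes "\<And>i j. coeff (coeff p j) i \<noteq> 0 \<Longrightarrow> i + j \<le> n"
  shows "total_degree p \<le> n"
  unfolding total_degree_def using finite_support2[of p] assms by (subst Max_le_iff) auto

lemma le_total_degree:
  assumes "coeff (coeff p j) i \<noteq> 0"
  shows "i + j \<le> total_degree p"
  unfolding total_degree_def using finite_support2[of p] assms by (intro Max_ge) auto

lemma total_degree_affine: "total_degree (const2 a + const2 b * X1 + const2 c * X2) \<le> 1"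
  by (rule total_degree_le)
    (auto simp: const2_def X1_def X2_def coeff_pCons split: nat.splits if_splits)

text \<open>Twice the signed area of the triangle, the determinant of the two edge vectors at
  \<open>w0\<close>.\<close>

fun triangle_det :: "vertices \<Rightarrow> real" where
  "triangle_det (w0, w1, w2) =
     (w1 $ 1 - w0 $ 1) * (w2 $ 2 - w0 $ 2) - (w2 $ 1 - w0 $ 1) * (w1 $ 2 - w0 $ 2)"

lemma affinely_independent_iff: "affinely_independent w \<longleftrightarrow> triangle_det w \<noteq> 0"
proof -
  obtain w0 w1 w2 where w: "w = (w0, w1, w2)" by (cases w)
  \<comment> \<open>For three points, distinctness plus affine independence amounts to not being
    collinear; translating \<open>w0\<close> to the origin leaves parallelism of the edge
    vectors.\<close>
  have "affinely_independent w \<longleftrightarrow> \<not> collinear {w1, w0, w2}"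
    by (auto simp: w collinear_3_eq_affine_dependent insert_commute)
  also have "collinear {w1, w0, w2} \<longleftrightarrow> collinear {0, w1 - w0, w2 - w0}"
    by (simp add: collinear_3[of w1 w0 w2])
  also have "\<dots> \<longleftrightarrow> triangle_det w = 0"
  proof
    assume "collinear {0, w1 - w0, w2 - w0}"
    then consider "w1 = w0" | "w2 = w0" | c where "w2 - w0 = c *\<^sub>R (w1 - w0)"
      by (auto simp: collinear_lemma)
    then show "triangle_det w = 0"
    proof cases
      case 3
      then have "w2 $ 1 - w0 $ 1 = c * (w1 $ 1 - w0 $ 1)" "w2 $ 2 - w0 $ 2 = c * (w1 $ 2 - w0 $ 2)"
        by (auto simp: vec2_eq_iff)
      then show ?thesis by (simp add: w)
    qed (simp_all add: w)
  next
    assume *: "triangle_det w = 0"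
    define a b where "a = w1 - w0" and "b = w2 - w0"
    have eq: "a $ 1 * b $ 2 = b $ 1 * a $ 2" using * by (simp add: w a_def b_def)
    have "\<exists>c. b = c *\<^sub>R a" if "a \<noteq> 0"
    proof -
      consider "a $ 1 \<noteq> 0" | "a $ 2 \<noteq> 0" using \<open>a \<noteq> 0\<close> by (metis vec2_eq_iff zero_index)
      then show ?thesis
      proof cases
        case 1
        then show ?thesis using eq
          by (intro exI[of _ "b $ 1 / a $ 1"]) (simp add: vec2_eq_iff field_simps)
      next
        case 2
        then show ?thesis using eq
          by (intro exI[of _ "b $ 2 / a $ 2"]) (simp add: vec2_eq_iff field_simps)
      qed
    qed
    then show "collinear {0, w1 - w0, w2 - w0}"
      unfolding a_def b_def collinear_lemma by auto
  qed
  finally show ?thesis by blast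
qed

lemma affine_combination_unique:
  assumes "affinely_independent (w0, w1, w2)"
    and "a0 + a1 + a2 = 1" "b0 + b1 + b2 = 1"
    and "a0 *\<^sub>R w0 + a1 *\<^sub>R w1 + a2 *\<^sub>R w2 = b0 *\<^sub>R w0 + b1 *\<^sub>R w1 + b2 *\<^sub>R w2"
  shows "a0 = b0 \<and> a1 = b1 \<and> a2 = b2"
proof -
  define c1 c2 where "c1 = a1 - b1" and "c2 = a2 - b2"
  have a: "a1 = b1 + c1" "a2 = b2 + c2" "a0 = b0 - c1 - c2"
    using assms(2,3) by (auto simp: c1_def c2_def)
  \<comment> \<open>The differences of the weights solve a homogeneous linear system with
    determinant \<open>triangle_det\<close>; eliminating one unknown at a time is Cramer's
    rule.\<close>
  have "c1 * (w1 $ 1 - w0 $ 1) + c2 * (w2 $ 1 - w0 $ 1) = 0"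
    "c1 * (w1 $ 2 - w0 $ 2) + c2 * (w2 $ 2 - w0 $ 2) = 0"
    using assms(4) by (auto simp: a vec2_eq_iff algebra_simps)
  then have "c1 * triangle_det (w0, w1, w2) = 0" "c2 * triangle_det (w0, w1, w2) = 0"
    unfolding triangle_det.simps by algebra+
  then show ?thesis using assms(1) a by (simp add: affinely_independent_iff del: triangle_det.simps)
qed

lemma is_barycentric_eval2:
  assumes "is_barycentric (w0, w1, w2) (l0, l1, l2)"
  shows "eval2 l0 x + eval2 l1 x + eval2 l2 x = 1"
    and "x = eval2 l0 x *\<^sub>R w0 + eval2 l1 x *\<^sub>R w1 + eval2 l2 x *\<^sub>R w2"
proof -
  have "eval2 (l0 + l1 + l2) x = 1" using assms by simp
  then show "eval2 l0 x + eval2 l1 x + eval2 l2 x = 1" by simp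
  show "x = eval2 l0 x *\<^sub>R w0 + eval2 l1 x *\<^sub>R w1 + eval2 l2 x *\<^sub>R w2"
    using assms by simp
qed

lemma is_barycentric_eval2_eq:
  assumes "affinely_independent (w0, w1, w2)" "is_barycentric (w0, w1, w2) (l0, l1, l2)"
    and "a0 + a1 + a2 = 1" "x = a0 *\<^sub>R w0 + a1 *\<^sub>R w1 + a2 *\<^sub>R w2"
  shows "eval2 l0 x = a0 \<and> eval2 l1 x = a1 \<and> eval2 l2 x = a2"
  using affine_combination_unique[OF assms(1) is_barycentric_eval2(1)[OF assms(2)] assms(3)]
    is_barycentric_eval2(2)[OF assms(2)] assms(4) by metis

lemma is_barycentric_unique:
  assumes "affinely_independent w" "is_barycentric w l" "is_barycentric w l'"
  shows "l = l'"
proof -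
  obtain w0 w1 w2 l0 l1 l2 l0' l1' l2'
    where w: "w = (w0, w1, w2)" and l: "l = (l0, l1, l2)" and l': "l' = (l0', l1', l2')"
    by (cases w, cases l, cases l')
  note bary = assms(2)[unfolded w l] and bary' = assms(3)[unfolded w l']
  have "eval2 l0 x = eval2 l0' x \<and> eval2 l1 x = eval2 l1' x \<and> eval2 l2 x = eval2 l2' x" for x
    by (rule is_barycentric_eval2_eq[OF assms(1)[unfolded w] bary is_barycentric_eval2[OF bary']])
  then show ?thesis by (simp add: l l' poly2_eqI)
qed

lemma ex_is_barycentric:
  assumes "affinely_independent w"
  shows "\<exists>l. is_barycentric w l"
proof -
  obtain w0 w1 w2 where w: "w = (w0, w1, w2)" by (cases w)
  define D where "D = triangle_det w"
  have D: "D \<noteq> 0" using assms by (simp add: D_def affinely_independent_iff)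
  \<comment> \<open>\<open>p a b\<close> at \<open>x\<close> is the signed area of the triangle
    \<open>x\<close>, \<open>a\<close>, \<open>b\<close> divided by that of \<open>w\<close>:
    barycentric coordinates are ratios of areas.\<close>
  define p where "p a b = const2 ((a $ 1 * b $ 2 - b $ 1 * a $ 2) / D)
    + const2 ((a $ 2 - b $ 2) / D) * X1 + const2 ((b $ 1 - a $ 1) / D) * X2"
    for a b :: "real ^ 2"
  have D': "D = (w1 $ 1 - w0 $ 1) * (w2 $ 2 - w0 $ 2) - (w2 $ 1 - w0 $ 1) * (w1 $ 2 - w0 $ 2)"
    by (simp add: D_def w)
  have p: "D * eval2 (p a b) x
      = a $ 1 * b $ 2 - b $ 1 * a $ 2 + (a $ 2 - b $ 2) * x $ 1 + (b $ 1 - a $ 1) * x $ 2" for a b x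
    using D by (simp add: p_def field_simps)
  \<comment> \<open>The identities below are checked after multiplication by \<open>D\<close>, where
    \<open>p\<close> has no denominators.\<close>
  have cancel: "y = z" if "D * y = D * z" for y z using that D by simp
  have "p w1 w2 + p w2 w0 + p w0 w1 = 1"
  proof (rule poly2_eqI)
    fix x :: "real ^ 2"
    show "eval2 (p w1 w2 + p w2 w0 + p w0 w1) x = eval2 1 x"
      by (rule cancel) (simp add: distrib_left p, simp add: D' algebra_simps)
  qed
  moreover have "x = eval2 (p w1 w2) x *\<^sub>R w0 + eval2 (p w2 w0) x *\<^sub>R w1 + eval2 (p w0 w1) x *\<^sub>R w2" for x
    unfolding vec2_eq_iff
    by (intro conjI; rule cancel; simp add: distrib_left mult.assoc[symmetric] p; simp add: D' algebra_simps)
  moreover have "total_degree (p a b) \<le> 1" for a b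
    unfolding p_def by (rule total_degree_affine)
  ultimately show ?thesis
    by (intro exI[of _ "(p w1 w2, p w2 w0, p w0 w1)"]) (simp add: w)
qed

lemma barycentric_eqI:
  assumes "affinely_independent w" "is_barycentric w l"
  shows "barycentric w = l"
  unfolding barycentric_def using assms is_barycentric_unique by blast

lemma is_barycentric_barycentric:
  assumes "affinely_independent w"
  shows "is_barycentric w (barycentric w)"
  using ex_is_barycentric[OF assms] barycentric_eqI[OF assms] by metis

text \<open>The hull form gives closedness, membership of the vertices and independence of their
  order.\<close>

lemma simplex_of_eq_convex_hull:
  assumes "affinely_independent (w0, w1, w2)"
  shows "simplex_of (w0, w1, w2) = convex hull {w0, w1, w2}"
proof -
  obtain l0 l1 l2 where l: "barycentric (w0, w1, w2) = (l0, l1, l2)"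
    by (cases "barycentric (w0, w1, w2)")
  have bary: "is_barycentric (w0, w1, w2) (l0, l1, l2)"
    using is_barycentric_barycentric[OF assms] l by simp
  show ?thesis
  proof (intro equalityI subsetI)
    fix x assume "x \<in> simplex_of (w0, w1, w2)"
    then show "x \<in> convex hull {w0, w1, w2}"
      unfolding convex_hull_3 simplex_of_def l using is_barycentric_eval2[OF bary, of x] by auto
  next
    fix x assume "x \<in> convex hull {w0, w1, w2}"
    then obtain a b c where *: "a \<ge> 0" "b \<ge> 0" "c \<ge> 0" "a + b + c = 1"
      "x = a *\<^sub>R w0 + b *\<^sub>R w1 + c *\<^sub>R w2" unfolding convex_hull_3 by auto
    then show "x \<in> simplex_of (w0, w1, w2)"
      using is_barycentric_eval2_eq[OF assms bary *(4,5)] by (simp add: simplex_of_def l)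
  qed
qed

subsection \<open>Uniqueness of Bernstein coefficients\<close>

lemma finite_indices [simp]: "finite (indices d)"
  by (rule finite_subset[of _ "{..d} \<times> {..d} \<times> {..d}"]) (auto simp: indices_def)

lemma const2_monom: "const2 c = monom (monom c 0) 0"
  and X1_power: "X1 ^ i = monom (monom 1 i) 0"
  and X2_power: "X2 ^ j = monom 1 j"
proof -
  have X: "X1 = monom (monom 1 1) 0" "X2 = monom 1 1"
    by (simp_all add: X1_def X2_def monom_altdef)
  show "X1 ^ i = monom (monom 1 i) 0" "X2 ^ j = monom 1 j"
    unfolding X monom_power by simp_all
qed (simp add: const2_def monom_0)

lemma coeff2_const2_mult: "coeff (coeff (const2 c * p) j) i = c * coeff (coeff p j) i"
  by (simp add: const2_def)

lemma coeff2_X1_power_mult: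
  "coeff (coeff (X1 ^ k * p) j) i = (if i < k then 0 else coeff (coeff p j) (i - k))"
  by (simp add: X1_power monom_0 coeff_monom_mult)

lemma coeff2_X2_power_mult:
  "coeff (coeff (X2 ^ k * p) j) i = (if j < k then 0 else coeff (coeff p (j - k)) i)"
  by (simp add: X2_power coeff_monom_mult)

lemma coeff2_monomial:
  "coeff (coeff (const2 c * X1 ^ k * X2 ^ l) j) i = (if k = i \<and> l = j then c else 0)"
  by (simp add: const2_monom X1_power X2_power mult_monom)

text \<open>The condition under the definite description in \<open>bernstein_coeff\<close>, named so
  that uniqueness and existence can be proved separately.\<close>

definition bernstein_rep :: "poly2 \<Rightarrow> nat \<Rightarrow> vertices \<Rightarrow> (multi_index \<Rightarrow> real) \<Rightarrow> bool" where
  "bernstein_rep Q d w b \<longleftrightarrow> (\<forall>\<alpha>. \<alpha> \<notin> indices d \<longrightarrow> b \<alpha> = 0) \<and>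
     Q = (\<Sum>\<alpha>\<in>indices d. const2 (b \<alpha>) * bernstein_poly w d \<alpha>)"

fun multinomial :: "multi_index \<Rightarrow> real" where
  "multinomial (a0, a1, a2) = fact (a0 + a1 + a2) / (fact a0 * fact a1 * fact a2)"

lemma multinomial_pos: "multinomial \<alpha> > 0"
  by (cases \<alpha>) simp

fun bary_monom :: "poly2 \<times> poly2 \<times> poly2 \<Rightarrow> multi_index \<Rightarrow> poly2" where
  "bary_monom (l0, l1, l2) (a0, a1, a2) = l0 ^ a0 * l1 ^ a1 * l2 ^ a2"

lemma bernstein_poly_eq:
  "\<alpha> \<in> indices d \<Longrightarrow> bernstein_poly w d \<alpha> = const2 (multinomial \<alpha>) * bary_monom (barycentric w) \<alpha>"
  by (cases \<alpha>; cases "barycentric w") (auto simp: indices_def mult.assoc)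

text \<open>Homogenizing in the barycentric coordinates and then setting \<open>\<lambda>\<^sub>0 = 1\<close>
  turns Bernstein coefficients into ordinary polynomial coefficients.\<close>

definition dehomogenized :: "nat \<Rightarrow> (multi_index \<Rightarrow> real) \<Rightarrow> poly2" where
  "dehomogenized d b = (\<Sum>\<alpha>\<in>indices d. const2 (b \<alpha> * multinomial \<alpha>) * bary_monom (1, X1, X2) \<alpha>)"

text \<open>Since \<open>a0\<close> is determined by \<open>d\<close>, \<open>a1\<close> and
  \<open>a2\<close>, distinct indices of degree \<open>d\<close> give distinct monomials in
  \<open>X1\<close> and \<open>X2\<close>, so only one summand contributes.\<close>

lemma coeff2_dehomogenized:
  assumes "a0 + a1 + a2 = d"
  shows "coeff (coeff (dehomogenized d b) a2) a1 = b (a0, a1, a2) * multinomial (a0, a1, a2)"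
proof -
  have "coeff (coeff (const2 (b \<alpha> * multinomial \<alpha>) * bary_monom (1, X1, X2) \<alpha>) a2) a1
      = (if \<alpha> = (a0, a1, a2) then b \<alpha> * multinomial \<alpha> else 0)" if "\<alpha> \<in> indices d" for \<alpha>
    using that assms
    by (cases \<alpha>) (auto simp: coeff2_monomial[unfolded mult.assoc] indices_def simp del: multinomial.simps const2_simps)
  then have "coeff (coeff (dehomogenized d b) a2) a1
      = (\<Sum>\<alpha>\<in>indices d. if \<alpha> = (a0, a1, a2) then b \<alpha> * multinomial \<alpha> else 0)"
    by (simp add: dehomogenized_def coeff_sum del: const2_simps)
  also have "\<dots> = b (a0, a1, a2) * multinomial (a0, a1, a2)"
    using assms finite_indices[of d] by (subst sum.delta) (auto simp: indices_def simp del: multinomial.simps)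
  finally show ?thesis .
qed

text \<open>The point at which \<open>Q\<close> is evaluated has barycentric coordinates
  \<open>1 / t\<close>, \<open>x $ 1 / t\<close> and \<open>x $ 2 / t\<close>. Every Bernstein
  polynomial is homogeneous of degree \<open>d\<close> in these, so the factor \<open>t ^ d\<close>
  clears all denominators.\<close>

lemma eval2_bernstein_rep:
  assumes w: "affinely_independent (w0, w1, w2)" and rep: "bernstein_rep Q d (w0, w1, w2) b"
    and t: "t = 1 + x $ 1 + x $ 2" "t \<noteq> 0"
  shows "eval2 Q ((1 / t) *\<^sub>R (w0 + x $ 1 *\<^sub>R w1 + x $ 2 *\<^sub>R w2)) * t ^ d = eval2 (dehomogenized d b) x"
proof -
  define y where "y = (1 / t) *\<^sub>R (w0 + x $ 1 *\<^sub>R w1 + x $ 2 *\<^sub>R w2)"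
  obtain l0 l1 l2 where l: "barycentric (w0, w1, w2) = (l0, l1, l2)"
    by (cases "barycentric (w0, w1, w2)")
  have bary: "is_barycentric (w0, w1, w2) (l0, l1, l2)"
    using is_barycentric_barycentric[OF w] l by simp
  have ev: "eval2 l0 y = 1 / t" "eval2 l1 y = x $ 1 / t" "eval2 l2 y = x $ 2 / t"
  proof -
    have "1 / t + x $ 1 / t + x $ 2 / t = 1" using t by (simp add: add_divide_distrib[symmetric])
    from is_barycentric_eval2_eq[OF w bary this, of y]
    show "eval2 l0 y = 1 / t" "eval2 l1 y = x $ 1 / t" "eval2 l2 y = x $ 2 / t"
      by (simp_all add: y_def scaleR_add_right)
  qed
  have "eval2 (bernstein_poly (w0, w1, w2) d \<alpha>) y * t ^ d
      = multinomial \<alpha> * eval2 (bary_monom (1, X1, X2) \<alpha>) x" if "\<alpha> \<in> indices d" for \<alpha>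
    using that t(2)
    by (cases \<alpha>)
      (auto simp: bernstein_poly_eq l ev indices_def power_divide power_add field_simps
        simp del: bernstein_poly.simps multinomial.simps)
  then show ?thesis
    using rep unfolding y_def[symmetric] bernstein_rep_def dehomogenized_def
    by (simp add: sum_distrib_right mult.assoc del: bernstein_poly.simps)
qed

text \<open>On the open quadrant the dehomogenization takes values that depend on \<open>Q\<close>
  alone, so two representations share it and hence its coefficients. The multinomial factors cancel
  because they are positive.\<close>

lemma bernstein_rep_unique:
  assumes "affinely_independent w" "bernstein_rep Q d w b" "bernstein_rep Q d w b'"
  shows "b = b'"
proof
  fix \<alpha> :: multi_index
  obtain w0 w1 w2 where w: "w = (w0, w1, w2)" by (cases w)
  have "dehomogenized d b = dehomogenized d b'"
  proof (rule poly2_eqI)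
    fix x :: "real ^ 2" assume "x $ 1 > 0" "x $ 2 > 0"
    then have "1 + x $ 1 + x $ 2 \<noteq> 0" by linarith
    then show "eval2 (dehomogenized d b) x = eval2 (dehomogenized d b') x"
      using eval2_bernstein_rep[OF assms(1)[unfolded w] assms(2)[unfolded w] refl, of x]
        eval2_bernstein_rep[OF assms(1)[unfolded w] assms(3)[unfolded w] refl, of x] by simp
  qed
  moreover obtain a0 a1 a2 where \<alpha>: "\<alpha> = (a0, a1, a2)" by (cases \<alpha>)
  ultimately have "b \<alpha> * multinomial \<alpha> = b' \<alpha> * multinomial \<alpha>" if "\<alpha> \<in> indices d"
    using that coeff2_dehomogenized[of a0 a1 a2 d b] coeff2_dehomogenized[of a0 a1 a2 d b']
    by (auto simp: \<alpha> indices_def simp del: multinomial.simps)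
  moreover have "b \<alpha> = 0" "b' \<alpha> = 0" if "\<alpha> \<notin> indices d"
    using that assms(2,3) unfolding bernstein_rep_def by blast+
  ultimately show "b \<alpha> = b' \<alpha>"
    using multinomial_pos[of \<alpha>] by (cases "\<alpha> \<in> indices d") simp_all
qed

lemma bernstein_coeff_eqI:
  assumes "affinely_independent w" "bernstein_rep Q d w b"
  shows "bernstein_coeff Q d w = b"
  unfolding bernstein_coeff_def bernstein_rep_def[symmetric]
  by (rule the_equality, rule assms(2), rule bernstein_rep_unique[OF assms(1) _ assms(2)])

subsection \<open>Existence of Bernstein coefficients\<close>

text \<open>The span of the degree \<open>d\<close> products of barycentric coordinates, without
  multinomial factors, so that closure under products needs no rescaling.\<close>

definition bary_forms :: "poly2 \<times> poly2 \<times> poly2 \<Rightarrow> nat \<Rightarrow> poly2 set" where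
  "bary_forms l d = {Q. \<exists>c. Q = (\<Sum>\<alpha>\<in>indices d. const2 (c \<alpha>) * bary_monom l \<alpha>)}"

lemma bary_forms_add: "p \<in> bary_forms l d \<Longrightarrow> q \<in> bary_forms l d \<Longrightarrow> p + q \<in> bary_forms l d"
  unfolding bary_forms_def
proof clarify
  fix c c'
  show "\<exists>c''. (\<Sum>\<alpha>\<in>indices d. const2 (c \<alpha>) * bary_monom l \<alpha>) +
      (\<Sum>\<alpha>\<in>indices d. const2 (c' \<alpha>) * bary_monom l \<alpha>)
    = (\<Sum>\<alpha>\<in>indices d. const2 (c'' \<alpha>) * bary_monom l \<alpha>)"
    by (rule exI[of _ "\<lambda>\<alpha>. c \<alpha> + c' \<alpha>"]) (simp add: distrib_right sum.distrib)
qed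

lemma bary_forms_const2_mult: "p \<in> bary_forms l d \<Longrightarrow> const2 a * p \<in> bary_forms l d"
  unfolding bary_forms_def
proof clarify
  fix c
  show "\<exists>c'. const2 a * (\<Sum>\<alpha>\<in>indices d. const2 (c \<alpha>) * bary_monom l \<alpha>)
    = (\<Sum>\<alpha>\<in>indices d. const2 (c' \<alpha>) * bary_monom l \<alpha>)"
    by (rule exI[of _ "\<lambda>\<alpha>. a * c \<alpha>"]) (simp add: sum_distrib_left mult.assoc)
qed

lemma bary_forms_0: "0 \<in> bary_forms l d"
  unfolding bary_forms_def by (auto intro!: exI[of _ "\<lambda>_. 0"])

lemma bary_forms_sum: "(\<And>a. a \<in> A \<Longrightarrow> f a \<in> bary_forms l d) \<Longrightarrow> sum f A \<in> bary_forms l d"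
  by (induction A rule: infinite_finite_induct) (auto intro: bary_forms_0 bary_forms_add)

lemma bary_monom_in_bary_forms: "\<alpha> \<in> indices d \<Longrightarrow> bary_monom l \<alpha> \<in> bary_forms l d"
  unfolding bary_forms_def
proof clarify
  assume "\<alpha> \<in> indices d"
  moreover have "const2 (if \<beta> = \<alpha> then 1 else 0) * bary_monom l \<beta>
      = (if \<beta> = \<alpha> then bary_monom l \<alpha> else 0)" for \<beta>
    by simp
  ultimately show "\<exists>c. bary_monom l \<alpha> = (\<Sum>\<alpha>\<in>indices d. const2 (c \<alpha>) * bary_monom l \<alpha>)"
    by (intro exI[of _ "\<lambda>\<beta>. if \<beta> = \<alpha> then 1 else 0"]) simp
qed

lemma bary_forms_mult_coordinate:
  assumes "p \<in> bary_forms (l0, l1, l2) d" "l \<in> {l0, l1, l2}"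
  shows "l * p \<in> bary_forms (l0, l1, l2) (Suc d)"
proof -
  let ?l = "(l0, l1, l2)"
  have mon: "l * bary_monom ?l \<alpha> \<in> bary_forms ?l (Suc d)" if "\<alpha> \<in> indices d" for \<alpha>
  proof -
    obtain a0 a1 a2 where \<alpha>: "\<alpha> = (a0, a1, a2)" by (cases \<alpha>)
    \<comment> \<open>Multiplying by a coordinate raises exactly one of the three exponents.\<close>
    have "l * bary_monom ?l \<alpha> \<in> bary_monom ?l ` {(Suc a0, a1, a2), (a0, Suc a1, a2), (a0, a1, Suc a2)}"
      using assms(2) by (auto simp: \<alpha> ac_simps)
    then show ?thesis
      using that by (auto simp: \<alpha> indices_def intro!: bary_monom_in_bary_forms simp del: bary_monom.simps)
  qed
  obtain c where "p = (\<Sum>\<alpha>\<in>indices d. const2 (c \<alpha>) * bary_monom ?l \<alpha>)"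
    using assms(1) by (auto simp: bary_forms_def)
  then have "l * p = (\<Sum>\<alpha>\<in>indices d. const2 (c \<alpha>) * (l * bary_monom ?l \<alpha>))"
    by (simp add: sum_distrib_left mult.left_commute)
  then show ?thesis using mon by (auto intro!: bary_forms_sum bary_forms_const2_mult)
qed

lemma bary_forms_mult_linear:
  assumes "p \<in> bary_forms (l0, l1, l2) d"
  shows "(const2 a * l0 + const2 b * l1 + const2 c * l2) * p \<in> bary_forms (l0, l1, l2) (Suc d)"
  unfolding distrib_right mult.assoc
  by (intro bary_forms_add bary_forms_const2_mult bary_forms_mult_coordinate assms) auto

context
  fixes w0 w1 w2 l0 l1 l2
  assumes bary: "is_barycentric (w0, w1, w2) (l0, l1, l2)"
begin

text \<open>Degree elevation: multiply by \<open>l0 + l1 + l2\<close>, which is 1.\<close>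

lemma bary_forms_Suc:
  assumes "p \<in> bary_forms (l0, l1, l2) d"
  shows "p \<in> bary_forms (l0, l1, l2) (Suc d)"
proof -
  have "l0 + l1 + l2 = 1" using bary by simp
  then show ?thesis using bary_forms_mult_linear[OF assms, of 1 1 1] by simp
qed

lemma bary_forms_mono:
  assumes "p \<in> bary_forms (l0, l1, l2) d" "d \<le> e"
  shows "p \<in> bary_forms (l0, l1, l2) e"
  using assms(2) by (induction rule: dec_induct) (simp_all add: assms(1) bary_forms_Suc)

text \<open>The components of the barycentric identity present \<open>X1\<close> and
  \<open>X2\<close> as linear forms in the barycentric coordinates, so multiplying by either one
  raises the degree of a form by one.\<close>

lemma coordinate_eq_bary:
  "X1 = const2 (w0 $ 1) * l0 + const2 (w1 $ 1) * l1 + const2 (w2 $ 1) * l2" (is "_ = ?p1")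
  "X2 = const2 (w0 $ 2) * l0 + const2 (w1 $ 2) * l1 + const2 (w2 $ 2) * l2" (is "_ = ?p2")
proof -
  have *: "eval2 X1 x = eval2 ?p1 x \<and> eval2 X2 x = eval2 ?p2 x" for x
  proof -
    have "x = eval2 l0 x *\<^sub>R w0 + eval2 l1 x *\<^sub>R w1 + eval2 l2 x *\<^sub>R w2"
      by (rule is_barycentric_eval2(2)[OF bary])
    from arg_cong[OF this, of "\<lambda>v. v $ 1"] arg_cong[OF this, of "\<lambda>v. v $ 2"]
    show ?thesis by (simp add: mult.commute)
  qed
  show "X1 = ?p1" "X2 = ?p2" by (rule poly2_eqI, rule *[THEN conjunct1], rule poly2_eqI, rule *[THEN conjunct2])
qed

lemma bary_forms_X1_mult: "p \<in> bary_forms (l0, l1, l2) d \<Longrightarrow> X1 * p \<in> bary_forms (l0, l1, l2) (Suc d)"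
  and bary_forms_X2_mult: "p \<in> bary_forms (l0, l1, l2) d \<Longrightarrow> X2 * p \<in> bary_forms (l0, l1, l2) (Suc d)"
  unfolding coordinate_eq_bary by (rule bary_forms_mult_linear, assumption)+

lemma monomial_in_bary_forms: "X1 ^ i * X2 ^ j \<in> bary_forms (l0, l1, l2) (i + j)"
proof (induction i)
  case 0
  have "1 \<in> bary_forms (l0, l1, l2) 0"
    using bary_monom_in_bary_forms[of "(0, 0, 0)" 0 "(l0, l1, l2)"] by (simp add: indices_def)
  then show ?case
    by (induction j) (simp_all add: bary_forms_X2_mult)
next
  case (Suc i)
  then show ?case by (simp add: bary_forms_X1_mult mult.assoc)
qed

end

lemma poly2_eq_sum_monomials:
  "p = (\<Sum>j\<le>degree p. \<Sum>i\<le>degree (coeff p j). const2 (coeff (coeff p j) i) * (X1 ^ i * X2 ^ j))"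
proof (rule poly2_eqI)
  fix x
  show "eval2 p x = eval2 (\<Sum>j\<le>degree p. \<Sum>i\<le>degree (coeff p j).
      const2 (coeff (coeff p j) i) * (X1 ^ i * X2 ^ j)) x"
  proof -
    have "eval2 p x = (\<Sum>j\<le>degree p. poly (coeff p j) (x $ 1) * x $ 2 ^ j)"
      unfolding eval2_def poly_altdef[of p] by (simp add: poly_sum)
    then show ?thesis
      by (simp add: poly_altdef[of "coeff p _" "x $ 1"] sum_distrib_right mult.assoc)
  qed
qed

text \<open>Each monomial of \<open>Q\<close> is a form of its own degree, obtained by multiplying
  linear forms, and is then elevated to the common degree \<open>d\<close>.\<close>

lemma ex_bernstein_rep:
  assumes w: "affinely_independent w" and d: "total_degree Q \<le> d"
  shows "\<exists>b. bernstein_rep Q d w b"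
proof -
  obtain w0 w1 w2 l0 l1 l2 where w': "w = (w0, w1, w2)" and l: "barycentric w = (l0, l1, l2)"
    by (cases w, cases "barycentric w")
  have bary: "is_barycentric (w0, w1, w2) (l0, l1, l2)"
    using is_barycentric_barycentric[OF w] l w' by simp
  have "const2 (coeff (coeff Q j) i) * (X1 ^ i * X2 ^ j) \<in> bary_forms (l0, l1, l2) d" for i j
  proof (cases "coeff (coeff Q j) i = 0")
    case False
    then have "i + j \<le> d" using le_total_degree d by (meson order_trans)
    then show ?thesis
      by (intro bary_forms_const2_mult bary_forms_mono[OF bary monomial_in_bary_forms[OF bary]])
  qed (simp add: bary_forms_0)
  note monomials_in = this
  have "Q \<in> bary_forms (l0, l1, l2) d"
    by (subst poly2_eq_sum_monomials[of Q]) (intro bary_forms_sum monomials_in)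
  then obtain c where c: "Q = (\<Sum>\<alpha>\<in>indices d. const2 (c \<alpha>) * bary_monom (l0, l1, l2) \<alpha>)"
    by (auto simp: bary_forms_def)
  \<comment> \<open>Bernstein polynomials carry the multinomial factor, which is divided out here;
    the value 0 elsewhere is the convention of \<open>bernstein_rep\<close>.\<close>
  define b where "b \<alpha> = (if \<alpha> \<in> indices d then c \<alpha> / multinomial \<alpha> else 0)" for \<alpha>
  have "const2 (b \<alpha>) * bernstein_poly w d \<alpha> = const2 (c \<alpha>) * bary_monom (l0, l1, l2) \<alpha>"
    if "\<alpha> \<in> indices d" for \<alpha>
  proof -
    have "const2 (b \<alpha>) * const2 (multinomial \<alpha>) = const2 (c \<alpha>)"
      using that multinomial_pos[of \<alpha>] by (simp add: b_def const2_simps(7)[symmetric] del: const2_simps)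
    then show ?thesis using that by (simp add: bernstein_poly_eq l mult.assoc[symmetric])
  qed
  then have "bernstein_rep Q d w b" using c by (simp add: bernstein_rep_def b_def)
  then show ?thesis by blast
qed

lemma bernstein_rep_bernstein_coeff:
  assumes "affinely_independent w" "total_degree Q \<le> d"
  shows "bernstein_rep Q d w (bernstein_coeff Q d w)"
proof -
  obtain b where b: "bernstein_rep Q d w b" using ex_bernstein_rep[OF assms] by blast
  then show ?thesis using bernstein_coeff_eqI[OF assms(1) b] by simp
qed

subsection \<open>Reordering the vertices\<close>

text \<open>The two adjacent transpositions generate all orderings of the vertices, so invariance is
  proved for these two only.\<close>

lemma affinely_independent_swap01:
  "affinely_independent (w0, w1, w2) \<Longrightarrow> affinely_independent (w1, w0, w2)"
  and affinely_independent_swap12: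
  "affinely_independent (w0, w1, w2) \<Longrightarrow> affinely_independent (w0, w2, w1)"
  by (simp_all add: insert_commute) auto

lemma barycentric_swap01:
  assumes "affinely_independent (w0, w1, w2)" "barycentric (w0, w1, w2) = (l0, l1, l2)"
  shows "barycentric (w1, w0, w2) = (l1, l0, l2)"
proof (rule barycentric_eqI)
  show "is_barycentric (w1, w0, w2) (l1, l0, l2)"
    using is_barycentric_barycentric[OF assms(1)] unfolding assms(2) by (simp add: add_ac)
qed (rule affinely_independent_swap01[OF assms(1)])

lemma barycentric_swap12:
  assumes "affinely_independent (w0, w1, w2)" "barycentric (w0, w1, w2) = (l0, l1, l2)"
  shows "barycentric (w0, w2, w1) = (l0, l2, l1)"
proof (rule barycentric_eqI)
  show "is_barycentric (w0, w2, w1) (l0, l2, l1)"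
    using is_barycentric_barycentric[OF assms(1)] unfolding assms(2) by (simp add: add_ac)
qed (rule affinely_independent_swap12[OF assms(1)])

lemma simplex_of_swap01:
  "affinely_independent (w0, w1, w2) \<Longrightarrow> simplex_of (w1, w0, w2) = simplex_of (w0, w1, w2)"
  and simplex_of_swap12:
  "affinely_independent (w0, w1, w2) \<Longrightarrow> simplex_of (w0, w2, w1) = simplex_of (w0, w1, w2)"
  using affinely_independent_swap01[of w0 w1 w2] affinely_independent_swap12[of w0 w1 w2]
  by (simp_all add: simplex_of_eq_convex_hull insert_commute del: affinely_independent.simps)

lemma bernstein_rep_swap01:
  assumes w: "affinely_independent (w0, w1, w2)" and rep: "bernstein_rep Q d (w0, w1, w2) b"
  shows "bernstein_rep Q d (w1, w0, w2) (\<lambda>(a0, a1, a2). b (a1, a0, a2))"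
proof -
  obtain l0 l1 l2 where l: "barycentric (w0, w1, w2) = (l0, l1, l2)"
    by (cases "barycentric (w0, w1, w2)")
  have "(\<Sum>\<alpha>\<in>indices d. const2 (b \<alpha>) * bernstein_poly (w0, w1, w2) d \<alpha>)
    = (\<Sum>\<alpha>\<in>indices d. const2 (case \<alpha> of (a0, a1, a2) \<Rightarrow> b (a1, a0, a2)) * bernstein_poly (w1, w0, w2) d \<alpha>)"
    by (rule sum.reindex_bij_witness[of _ "\<lambda>(a0, a1, a2). (a1, a0, a2)" "\<lambda>(a0, a1, a2). (a1, a0, a2)"])
      (auto simp: indices_def l barycentric_swap01[OF w l] mult_ac)
  with rep show ?thesis unfolding bernstein_rep_def by (auto simp: indices_def)
qed

lemma bernstein_rep_swap12:
  assumes w: "affinely_independent (w0, w1, w2)" and rep: "bernstein_rep Q d (w0, w1, w2) b"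
  shows "bernstein_rep Q d (w0, w2, w1) (\<lambda>(a0, a1, a2). b (a0, a2, a1))"
proof -
  obtain l0 l1 l2 where l: "barycentric (w0, w1, w2) = (l0, l1, l2)"
    by (cases "barycentric (w0, w1, w2)")
  have "(\<Sum>\<alpha>\<in>indices d. const2 (b \<alpha>) * bernstein_poly (w0, w1, w2) d \<alpha>)
    = (\<Sum>\<alpha>\<in>indices d. const2 (case \<alpha> of (a0, a1, a2) \<Rightarrow> b (a0, a2, a1)) * bernstein_poly (w0, w2, w1) d \<alpha>)"
    by (rule sum.reindex_bij_witness[of _ "\<lambda>(a0, a1, a2). (a0, a2, a1)" "\<lambda>(a0, a1, a2). (a0, a2, a1)"])
      (auto simp: indices_def l barycentric_swap12[OF w l] mult_ac)
  with rep show ?thesis unfolding bernstein_rep_def by (auto simp: indices_def)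
qed

text \<open>Reordering the vertices permutes the indices of the coefficients. The degree bound
  ensures that the coefficients exist, so that \<open>bernstein_coeff\<close> is meaningful.\<close>

lemma nonneg_certificate_swap:
  assumes w: "affinely_independent (w0, w1, w2)" and Q: "total_degree Q \<le> d"
    and cert: "nonneg_certificate Q d (w0, w1, w2)"
  shows "nonneg_certificate Q d (w1, w0, w2)" "nonneg_certificate Q d (w0, w2, w1)"
proof -
  note rep = bernstein_rep_bernstein_coeff[OF w Q]
  show "nonneg_certificate Q d (w1, w0, w2)" "nonneg_certificate Q d (w0, w2, w1)"
    unfolding nonneg_certificate_def
      bernstein_coeff_eqI[OF affinely_independent_swap01[OF w] bernstein_rep_swap01[OF w rep]]
      bernstein_coeff_eqI[OF affinely_independent_swap12[OF w] bernstein_rep_swap12[OF w rep]]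
    using cert by (auto simp: nonneg_certificate_def indices_def)
qed

subsection \<open>The triangle at the corner\<close>

lemma affinely_independent_standard: "affinely_independent (v0, v1, v2)"
  by (simp add: affinely_independent_iff v0_def v1_def v2_def del: affinely_independent.simps)

lemma barycentric_standard: "barycentric (v0, v1, v2) = (1 - X1 - X2, X1, X2)"
proof (rule barycentric_eqI[OF affinely_independent_standard])
  have "total_degree (1 - X1 - X2) \<le> 1" "total_degree X1 \<le> 1" "total_degree X2 \<le> 1"
    using total_degree_affine[of 1 "- 1" "- 1"] total_degree_affine[of 0 1 0] total_degree_affine[of 0 0 1]
    by simp_all
  then show "is_barycentric (v0, v1, v2) (1 - X1 - X2, X1, X2)"
    by (simp add: vec2_eq_iff v0_def v1_def v2_def)
qed

lemma simplex_of_standard: "simplex_of (v0, v1, v2) = {x. x $ 1 \<ge> 0 \<and> x $ 2 \<ge> 0 \<and> x $ 1 + x $ 2 \<le> 1}"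
  by (auto simp: simplex_of_def barycentric_standard)

lemma closed_simplex_of:
  assumes "affinely_independent w"
  shows "closed (simplex_of w)"
proof -
  obtain w0 w1 w2 where "w = (w0, w1, w2)" by (cases w)
  then show ?thesis
    using simplex_of_eq_convex_hull[of w0 w1 w2] assms
    by (simp add: compact_imp_closed finite_imp_compact_convex_hull del: affinely_independent.simps)
qed

lemma vertices_in_simplex_of:
  assumes "affinely_independent (w0, w1, w2)"
  shows "{w0, w1, w2} \<subseteq> simplex_of (w0, w1, w2)"
  unfolding simplex_of_eq_convex_hull[OF assms] by (rule hull_subset)

lemma triangulates_triangle:
  assumes "triangulates \<T> S" "T \<in> \<T>"
  obtains w where "affinely_independent w" "T = simplex_of w"
proof -
  have "\<forall>T\<in>\<T>. \<exists>w. affinely_independent w \<and> T = simplex_of w"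
    using assms(1) by (simp add: triangulates_def)
  with assms(2) that show thesis by blast
qed

text \<open>A triangle containing the origin might leave the second axis at once. Pigeonhole on a
  sequence on that axis tending to the origin picks one triangle, and closedness adds the
  limit.\<close>

lemma triangulation_contains_corner:
  assumes "triangulates \<T> (simplex_of (v0, v1, v2))"
  obtains T s where "T \<in> \<T>" "T \<subseteq> {x. x $ 1 \<ge> 0 \<and> x $ 2 \<ge> 0}"
    "0 \<in> T" "s > 0" "vector [0, s] \<in> T"
proof -
  define e :: "nat \<Rightarrow> real ^ 2" where "e n = vector [0, inverse (real (Suc n))]" for n
  have fin: "finite \<T>" and un: "\<Union>\<T> = simplex_of (v0, v1, v2)"
    using assms by (auto simp: triangulates_def)
  have "e n \<in> \<Union>\<T>" for n
    by (simp add: un simplex_of_standard e_def inverse_le_1_iff)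
  then have "\<forall>n. \<exists>T. T \<in> \<T> \<and> e n \<in> T" by blast
  from choice[OF this] obtain g where "\<forall>n. g n \<in> \<T> \<and> e n \<in> g n" ..
  then have g: "g n \<in> \<T>" "e n \<in> g n" for n by simp_all
  then have "range g \<subseteq> \<T>" by auto
  then have "finite (range g)" using fin by (rule finite_subset)
  from pigeonhole_infinite[OF infinite_UNIV_nat this]
  obtain n0 where "infinite {n. g n = g n0}" by (elim bexE) simp
  from infinite_enumerate[OF this] obtain r :: "nat \<Rightarrow> nat"
    where r: "strict_mono r" "\<And>n. g (r n) = g n0" by (elim exE conjE) simp
  have "e = (\<lambda>n. inverse (real (Suc n)) *\<^sub>R vector [0, 1])"
    by (simp add: fun_eq_iff e_def vec2_eq_iff)
  moreover have "(\<lambda>n. inverse (real (Suc n)) *\<^sub>R (vector [0, 1] :: real ^ 2)) \<longlonglongrightarrow> 0 *\<^sub>R vector [0, 1]"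
    by (rule tendsto_scaleR[OF LIMSEQ_inverse_real_of_nat tendsto_const])
  ultimately have "e \<longlonglongrightarrow> 0" by simp
  then have "(e \<circ> r) \<longlonglongrightarrow> 0" by (rule LIMSEQ_subseq_LIMSEQ[OF _ r(1)])
  moreover have "closed (g n0)"
  proof -
    obtain w where "affinely_independent w" "g n0 = simplex_of w"
      using triangulates_triangle[OF assms g(1)[of n0]] .
    then show ?thesis using closed_simplex_of by simp
  qed
  moreover have "(e \<circ> r) n \<in> g n0" for n using g(2)[of "r n"] r(2) by simp
  ultimately have "0 \<in> g n0"
    using closed_sequentially[of "g n0" "e \<circ> r" 0] by simp
  moreover have "g n0 \<subseteq> {x. x $ 1 \<ge> 0 \<and> x $ 2 \<ge> 0}"
    using un g(1)[of n0] unfolding simplex_of_standard by blast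
  ultimately show ?thesis
    using that[of "g n0" "inverse (real (Suc n0))"] g[of n0] by (simp add: e_def)
qed

text \<open>Since \<open>0\<close> is an extreme point of the quadrant and the second axis meets it in a face,
  a triangle containing \<open>0\<close> and a further point of the axis has an edge there.\<close>

lemma corner_triangle_reordering:
  assumes w: "affinely_independent w" "T = simplex_of w" "R w"
    and swap: "\<And>w0 w1 w2. affinely_independent (w0, w1, w2) \<Longrightarrow> R (w0, w1, w2) \<Longrightarrow> R (w1, w0, w2) \<and> R (w0, w2, w1)"
    and T: "T \<subseteq> {x. x $ 1 \<ge> 0 \<and> x $ 2 \<ge> 0}" "0 \<in> T" "s > 0" "vector [0, s] \<in> T"
  shows "\<exists>w1 w2. affinely_independent (0, w1, w2) \<and> T = simplex_of (0, w1, w2) \<and> R (0, w1, w2) \<and>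
    w1 $ 1 > 0 \<and> w2 $ 1 = 0 \<and> w2 $ 2 > 0"
proof -
  \<comment> \<open>\<open>R\<close> is a property carried along under reordering: trivially true
    for the claim in degree 4, the certificate itself for the impossibility claim.\<close>
  define P where "P w \<longleftrightarrow> affinely_independent w \<and> T = simplex_of w \<and> R w" for w
  have swap01: "P (w1, w0, w2)" and swap12: "P (w0, w2, w1)" if "P (w0, w1, w2)" for w0 w1 w2
    using that swap affinely_independent_swap01 affinely_independent_swap12 simplex_of_swap01 simplex_of_swap12
    unfolding P_def by blast+
  have nonneg: "\<forall>v\<in>{w0, w1, w2}. v $ 1 \<ge> 0 \<and> v $ 2 \<ge> 0" if "P (w0, w1, w2)" for w0 w1 w2
    using vertices_in_simplex_of[of w0 w1 w2] that T(1) unfolding P_def by blast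
  have hull: "T = convex hull {w0, w1, w2}" if "P (w0, w1, w2)" for w0 w1 w2
    using that simplex_of_eq_convex_hull unfolding P_def by blast
  have "\<exists>w1 w2. P (0, w1, w2)"
  proof -
    obtain w0 w1 w2 where P: "P (w0, w1, w2)" using w unfolding P_def by (cases w) auto
    obtain a b c where abc: "a \<ge> 0" "b \<ge> 0" "c \<ge> 0" "a + b + c = 1"
      "0 = a *\<^sub>R w0 + b *\<^sub>R w1 + c *\<^sub>R w2"
      using T(2) unfolding hull[OF P] convex_hull_3 by blast
    \<comment> \<open>Each component of the origin is a sum of nonnegative terms, so all of them
      vanish and a vertex with nonzero weight is the origin.\<close>
    have "a * w0 $ i + b * w1 $ i + c * w2 $ i = 0" for i
      using arg_cong[OF abc(5), of "\<lambda>v. v $ i"] by simp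
    moreover have "a * w0 $ i \<ge> 0" "b * w1 $ i \<ge> 0" "c * w2 $ i \<ge> 0" for i
      using nonneg[OF P] abc exhaust_2[of i] by auto
    ultimately have *: "a * w0 $ i = 0" "b * w1 $ i = 0" "c * w2 $ i = 0" for i
      by (smt (verit))+
    consider "a \<noteq> 0" | "b \<noteq> 0" | "c \<noteq> 0" using abc(4) by fastforce
    then have "w0 = 0 \<or> w1 = 0 \<or> w2 = 0" using * by cases (auto simp: vec_eq_iff)
    then show ?thesis using P swap01 swap12 by blast
  qed
  then obtain w1 w2 where P: "P (0, w1, w2)" by blast
  obtain a b c where abc: "a \<ge> 0" "b \<ge> 0" "c \<ge> 0" "a + b + c = 1"
    "vector [0, s] = a *\<^sub>R 0 + b *\<^sub>R w1 + c *\<^sub>R w2"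
    using T(4) unfolding hull[OF P] convex_hull_3 by blast
  have sum: "b * w1 $ 1 + c * w2 $ 1 = 0" "b * w1 $ 2 + c * w2 $ 2 = s"
    using arg_cong[OF abc(5), of "\<lambda>v. v $ 1"] arg_cong[OF abc(5), of "\<lambda>v. v $ 2"] by simp_all
  \<comment> \<open>The same argument in the first component: a vertex with nonzero weight lies on
    the second axis.\<close>
  moreover have "b * w1 $ 1 \<ge> 0" "c * w2 $ 1 \<ge> 0" using nonneg[OF P] abc by auto
  ultimately have "b * w1 $ 1 = 0" "c * w2 $ 1 = 0" by linarith+
  moreover have "b \<noteq> 0 \<or> c \<noteq> 0" using sum(2) T(3) by auto
  ultimately have "w1 $ 1 = 0 \<or> w2 $ 1 = 0" by auto
  then obtain u1 u2 where u: "P (0, u1, u2)" "u2 $ 1 = 0" using P swap12 by blast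
  \<comment> \<open>This product is \<open>triangle_det\<close> of the triangle, as
    \<open>u2 $ 1 = 0\<close>.\<close>
  then have "u1 $ 1 * u2 $ 2 \<noteq> 0"
    by (simp add: P_def affinely_independent_iff del: affinely_independent.simps)
  then have "u1 $ 1 > 0" "u2 $ 2 > 0" using nonneg[OF u(1)] by (auto simp: less_le)
  then show ?thesis using u unfolding P_def by blast
qed

subsection \<open>The polynomial \<open>P\<close>\<close>

text \<open>\<open>P\<close> homogenized by \<open>t\<close>, over an arbitrary ring since it is evaluated both at real numbers
  and at elements of \<^typ>\<open>poly2\<close>.\<close>

definition homP :: "'a::comm_ring_1 \<Rightarrow> 'a \<Rightarrow> 'a \<Rightarrow> 'a" where
  "homP x y t = 21 * x ^ 4 + 24 * x ^ 3 * y - 36 * x ^ 3 * t + 18 * x ^ 2 * y ^ 2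
     - 24 * x ^ 2 * y * t + 18 * x ^ 2 * t ^ 2 + 12 * x * y ^ 3 - 12 * x * y ^ 2 * t + 30 * y ^ 4"

lemma polyP_eq_homP: "polyP = homP X1 X2 1"
  by (simp add: polyP_def homP_def)

lemma eval2_polyP: "eval2 polyP x = homP (x $ 1) (x $ 2) 1"
  by (simp add: polyP_def homP_def)

lemma homP_sum_of_squares:
  "homP x y 1 = 2 * (3 * x - 3 * x ^ 2 - 2 * (x * y) - y ^ 2) ^ 2 + 3 * (x ^ 2 - 2 * y ^ 2) ^ 2
     + (x * y + 2 * y ^ 2) ^ 2 + 9 * (x * y) ^ 2 + 12 * (y ^ 2) ^ 2"
  by (simp add: homP_def power2_eq_square power3_eq_cube power4_eq_xxxx algebra_simps)

lemma homP_homogeneous: "homP (x * t) (y * t) t = homP x y 1 * t ^ 4"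
  by (simp add: homP_def power2_eq_square power3_eq_cube power4_eq_xxxx algebra_simps)

text \<open>The Bernstein expansion on the standard triangle, with \<open>1 - x - y\<close> as the
  coordinate of the origin. The factors 18, 12 and - 12 are the coefficients 3, 1 and - 1 times the
  multinomials 6, 12 and 12.\<close>

lemma homP_bernstein:
  "homP x y 1 = 18 * (1 - x - y) ^ 2 * x ^ 2 + 12 * (1 - x - y) * x ^ 2 * y
      - 12 * (1 - x - y) * x * y ^ 2 + 3 * x ^ 4 + 30 * y ^ 4"
  by (simp add: homP_def power2_eq_square power3_eq_cube power4_eq_xxxx algebra_simps)

text \<open>\<open>X\<close> and \<open>Y\<close> stand for the second and third barycentric
  coordinates, the first being set to 1. Multiples of \<open>X ^ 2\<close> or \<open>Y ^ 3\<close>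
  cannot contribute to the monomial \<open>X * Y ^ 2\<close>, so the cofactors \<open>A\<close> and
  \<open>B\<close> stay implicit.\<close>

lemma homP_expand:
  fixes X Y p q s :: "'a :: comm_ring_1"
  obtains A B where "homP (p * X) (q * X + s * Y) (1 + X + Y) = - 12 * p * s ^ 2 * (X * Y ^ 2) + X ^ 2 * A + Y ^ 3 * B"
proof -
  define x y t where "x = p * X" and "y = q * X + s * Y" and "t = 1 + X + Y"
  define c where "c = q ^ 2 * X + 2 * q * s * Y"
  have y2: "y ^ 2 = s ^ 2 * Y ^ 2 + X * c"
    by (simp add: y_def c_def power2_eq_square algebra_simps)
  have "homP x y t = p ^ 2 * X ^ 2 * (21 * x ^ 2 + 24 * x * y - 36 * x * t + 18 * y ^ 2 - 24 * y * t + 18 * t ^ 2)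
      + 12 * p * X * y ^ 2 * (y - t) + 30 * (y ^ 2) ^ 2"
    by (simp add: homP_def x_def power2_eq_square power3_eq_cube power4_eq_xxxx algebra_simps)
  \<comment> \<open>The distinguished negative term arises from the constant term 1 of
    \<open>t\<close>, that is, from the barycentric coordinate of the origin.\<close>
  also have "12 * p * X * y ^ 2 * (y - t)
     = - 12 * p * s ^ 2 * (X * Y ^ 2) + X ^ 2 * (12 * p * c * (y - t) + 12 * p * s ^ 2 * Y ^ 2 * (q - 1)) + Y ^ 3 * (12 * p * s ^ 2 * X * (s - 1))"
    unfolding y2 by (simp add: y_def t_def power2_eq_square power3_eq_cube algebra_simps)
  also have "30 * (y ^ 2) ^ 2 = X ^ 2 * (30 * (c ^ 2 + 2 * s ^ 2 * q ^ 2 * Y ^ 2)) + Y ^ 3 * (30 * s ^ 3 * (s * Y + 4 * q * X))"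
    unfolding y2 by (simp add: c_def power2_eq_square power3_eq_cube algebra_simps)
  finally have "homP x y t = - 12 * p * s ^ 2 * (X * Y ^ 2)
    + X ^ 2 * (p ^ 2 * (21 * x ^ 2 + 24 * x * y - 36 * x * t + 18 * y ^ 2 - 24 * y * t + 18 * t ^ 2)
      + (12 * p * c * (y - t) + 12 * p * s ^ 2 * Y ^ 2 * (q - 1)) + 30 * (c ^ 2 + 2 * s ^ 2 * q ^ 2 * Y ^ 2))
    + Y ^ 3 * (12 * p * s ^ 2 * X * (s - 1) + 30 * s ^ 3 * (s * Y + 4 * q * X))"
    by (simp add: distrib_left mult_ac)
  then show ?thesis using that unfolding x_def y_def t_def by blast
qed

section \<open>Positivity and the Gram matrix of \<open>polyP\<close>\<close>

lemma sum_of_squares_pos: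
  fixes f g h k l :: real
  assumes "f \<noteq> 0 \<or> g \<noteq> 0 \<or> k \<noteq> 0 \<or> l \<noteq> 0"
  shows "2 * f ^ 2 + 3 * g ^ 2 + h ^ 2 + 9 * k ^ 2 + 12 * l ^ 2 > 0"
proof -
  have "f ^ 2 \<ge> 0" "g ^ 2 \<ge> 0" "h ^ 2 \<ge> 0" "k ^ 2 \<ge> 0" "l ^ 2 \<ge> 0" by simp_all
  moreover have "f ^ 2 > 0 \<or> g ^ 2 > 0 \<or> k ^ 2 > 0 \<or> l ^ 2 > 0" using assms by simp
  ultimately show ?thesis by linarith
qed

lemma eval2_polyP_pos:
  assumes "x \<noteq> 0"
  shows "eval2 polyP x > 0"
  unfolding eval2_polyP homP_sum_of_squares
proof (rule sum_of_squares_pos)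
  have "x $ 2 \<noteq> 0 \<or> x $ 1 \<noteq> 0" using assms by (auto simp: vec2_eq_iff)
  \<comment> \<open>If \<open>x $ 2 = 0\<close>, the second form reduces to the square of
    \<open>x $ 1\<close>.\<close>
  then have "(x $ 2)\<^sup>2 \<noteq> 0 \<or> (x $ 1)\<^sup>2 - 2 * (x $ 2)\<^sup>2 \<noteq> 0" by auto
  then show "3 * x $ 1 - 3 * (x $ 1)\<^sup>2 - 2 * (x $ 1 * x $ 2) - (x $ 2)\<^sup>2 \<noteq> 0
      \<or> (x $ 1)\<^sup>2 - 2 * (x $ 2)\<^sup>2 \<noteq> 0 \<or> x $ 1 * x $ 2 \<noteq> 0 \<or> (x $ 2)\<^sup>2 \<noteq> 0"
    by blast
qed

lemma eval2_polyP_0: "eval2 polyP 0 = 0"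
  by (simp add: eval2_polyP homP_def)

text \<open>Complete the square in \<open>x\<close>, then in \<open>a\<close>; the remainder
  \<open>10 * b ^ 2 + 4 * b * c + 16 * c ^ 2\<close> splits into the last three squares with integer
  weights.\<close>

lemma Gram_form:
  fixes x :: "'a::comm_ring_1"
  shows "x * (18 * x - 18 * a - 12 * b - 6 * c) + a * (- 18 * x + 21 * a + 12 * b)
      + b * (- 12 * x + 12 * a + 18 * b + 6 * c) + c * (- 6 * x + 6 * b + 30 * c)
    = 2 * (3 * x - 3 * a - 2 * b - c) ^ 2 + 3 * (a - 2 * c) ^ 2 + (b + 2 * c) ^ 2 + 9 * b ^ 2 + 12 * c ^ 2"
  by (simp add: power2_eq_square algebra_simps)

lemma polyP_eq_Gram:
  "polyP = (\<Sum>i\<in>UNIV. monomials $ i * (map_matrix const2 M\<^sub>P *v monomials) $ i)"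
proof -
  define a b c where "a = X1 ^ 2" and "b = X1 * X2" and "c = X2 ^ 2"
  have mon: "monomials = vector [X1, a, b, c]" by (simp add: monomials_def a_def b_def c_def)
  have "(\<Sum>i\<in>UNIV. monomials $ i * (map_matrix const2 M\<^sub>P *v monomials) $ i)
    = X1 * (18 * X1 - 18 * a - 12 * b - 6 * c) + a * (- 18 * X1 + 21 * a + 12 * b)
      + b * (- 12 * X1 + 12 * a + 18 * b + 6 * c) + c * (- 6 * X1 + 6 * b + 30 * c)"
    unfolding mon by (simp add: sum_4 matrix_vector_mult_def M\<^sub>P_def)
  also have "\<dots> = polyP"
    unfolding Gram_form polyP_eq_homP homP_sum_of_squares by (simp add: a_def b_def c_def)
  finally show ?thesis ..
qed

lemma positive_definite_Gram: "positive_definite M\<^sub>P"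
  unfolding positive_definite_def
proof (intro conjI allI impI)
  show "transpose M\<^sub>P = M\<^sub>P"
    by (simp add: vec_eq_iff forall_4 transpose_def M\<^sub>P_def)
  fix x :: "real ^ 4" assume "x \<noteq> 0"
  define x1 a b c where "x1 = x $ 1" and "a = x $ 2" and "b = x $ 3" and "c = x $ 4"
  note x = x1_def[symmetric] a_def[symmetric] b_def[symmetric] c_def[symmetric]
  have "x \<bullet> (M\<^sub>P *v x) = x1 * (18 * x1 - 18 * a - 12 * b - 6 * c) + a * (- 18 * x1 + 21 * a + 12 * b)
      + b * (- 12 * x1 + 12 * a + 18 * b + 6 * c) + c * (- 6 * x1 + 6 * b + 30 * c)"
    by (simp add: inner_vec_def sum_4 matrix_vector_mult_def M\<^sub>P_def x)
  also have "\<dots> > 0"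
    unfolding Gram_form
  proof (rule sum_of_squares_pos)
    have "x1 \<noteq> 0 \<or> a \<noteq> 0 \<or> b \<noteq> 0 \<or> c \<noteq> 0"
      using \<open>x \<noteq> 0\<close> by (simp add: vec_eq_iff forall_4 x)
    \<comment> \<open>The forms are triangular: if \<open>b\<close> and \<open>c\<close> vanish, the
      second form gives \<open>a = 0\<close> and then the first gives \<open>x1 = 0\<close>.\<close>
    then show "3 * x1 - 3 * a - 2 * b - c \<noteq> 0 \<or> a - 2 * c \<noteq> 0 \<or> b \<noteq> 0 \<or> c \<noteq> 0" by linarith
  qed
  finally show "x \<bullet> (M\<^sub>P *v x) > 0" .
qed

section \<open>Degree and Bernstein coefficients of \<open>polyP\<close>\<close>

lemma total_degree_polyP: "total_degree polyP = 4"
proof (rule antisym)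
  have eq: "polyP = const2 21 * X1 ^ 4 * X2 ^ 0 + const2 24 * X1 ^ 3 * X2 ^ 1 + const2 (- 36) * X1 ^ 3 * X2 ^ 0
    + const2 18 * X1 ^ 2 * X2 ^ 2 + const2 (- 24) * X1 ^ 2 * X2 ^ 1 + const2 18 * X1 ^ 2 * X2 ^ 0
    + const2 12 * X1 ^ 1 * X2 ^ 3 + const2 (- 12) * X1 ^ 1 * X2 ^ 2 + const2 30 * X1 ^ 0 * X2 ^ 4"
    by (simp add: polyP_def)
  have coeff: "coeff (coeff polyP j) i = (if 4 = i \<and> 0 = j then 21 else 0) + (if 3 = i \<and> 1 = j then 24 else 0)
    + (if 3 = i \<and> 0 = j then - 36 else 0) + (if 2 = i \<and> 2 = j then 18 else 0)
    + (if 2 = i \<and> 1 = j then - 24 else 0) + (if 2 = i \<and> 0 = j then 18 else 0)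
    + (if 1 = i \<and> 3 = j then 12 else 0) + (if 1 = i \<and> 2 = j then - 12 else 0)
    + (if 0 = i \<and> 4 = j then 30 else 0)" for i j
    unfolding eq coeff_add coeff2_monomial ..
  show "total_degree polyP \<le> 4"
  proof (rule total_degree_le, rule ccontr)
    fix i j :: nat
    assume "\<not> i + j \<le> 4"
    then have "\<not> (4 = i \<and> 0 = j)" "\<not> (3 = i \<and> 1 = j)" "\<not> (3 = i \<and> 0 = j)" "\<not> (2 = i \<and> 2 = j)"
      "\<not> (2 = i \<and> 1 = j)" "\<not> (2 = i \<and> 0 = j)" "\<not> (1 = i \<and> 3 = j)" "\<not> (1 = i \<and> 2 = j)"
      "\<not> (0 = i \<and> 4 = j)" by linarith+
    then have "coeff (coeff polyP j) i = 0" unfolding coeff by (simp only: if_False add_0)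
    moreover assume "coeff (coeff polyP j) i \<noteq> 0"
    ultimately show False by contradiction
  qed
  show "4 \<le> total_degree polyP"
    using le_total_degree[of polyP 0 4] by (simp add: coeff)
qed

lemma bernstein_coeff_standard:
  assumes "\<alpha> \<in> indices 4"
  shows "bernstein_coeff polyP 4 (v0, v1, v2) \<alpha> =
       (if \<alpha> = (2, 2, 0) then 3 else if \<alpha> = (1, 2, 1) then 1
        else if \<alpha> = (1, 1, 2) then -1 else if \<alpha> = (0, 4, 0) then 3
        else if \<alpha> = (0, 0, 4) then 30 else 0)"
proof -
  define b :: "multi_index \<Rightarrow> real" where
    "b \<alpha> = (if \<alpha> = (2, 2, 0) then 3 else if \<alpha> = (1, 2, 1) then 1
        else if \<alpha> = (1, 1, 2) then -1 else if \<alpha> = (0, 4, 0) then 3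
        else if \<alpha> = (0, 0, 4) then 30 else 0)" for \<alpha>
  let ?I = "{(2, 2, 0), (1, 2, 1), (1, 1, 2), (0, 4, 0), (0, 0, 4)}"
  let ?w = "(v0, v1, v2)"
  have "(\<Sum>\<alpha>\<in>indices 4. const2 (b \<alpha>) * bernstein_poly ?w 4 \<alpha>)
      = (\<Sum>\<alpha>\<in>?I. const2 (b \<alpha>) * bernstein_poly ?w 4 \<alpha>)"
    by (rule sum.mono_neutral_right[OF finite_indices]) (auto simp: indices_def b_def)
  also have "\<dots> = 18 * (1 - X1 - X2) ^ 2 * X1 ^ 2 + 12 * (1 - X1 - X2) * X1 ^ 2 * X2
      - 12 * (1 - X1 - X2) * X1 * X2 ^ 2 + 3 * X1 ^ 4 + 30 * X2 ^ 4"
  proof -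
    have "fact 4 = (24 :: real)" by (simp add: fact_numeral)
    then show ?thesis by (simp add: b_def barycentric_standard)
  qed
  also have "\<dots> = polyP"
    unfolding polyP_eq_homP homP_bernstein ..
  finally have "bernstein_rep polyP 4 ?w b"
    by (auto simp: bernstein_rep_def indices_def b_def)
  then have "bernstein_coeff polyP 4 ?w = b"
    by (rule bernstein_coeff_eqI[OF affinely_independent_standard])
  then show ?thesis by (simp add: b_def)
qed

lemma eval2_polyP_homogeneous:
  assumes "t \<noteq> 0"
  shows "eval2 polyP ((1 / t) *\<^sub>R x) * t ^ 4 = homP (x $ 1) (x $ 2) t"
  unfolding eval2_polyP homP_homogeneous[symmetric] using assms by simp

lemma bernstein_coeff_polyP:
  assumes w: "affinely_independent (0, w1, w2)" and axis: "w2 $ 1 = 0" and d: "d \<ge> 4"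
  shows "bernstein_coeff polyP d (0, w1, w2) (d - 3, 1, 2) * multinomial (d - 3, 1, 2)
    = - 12 * w1 $ 1 * (w2 $ 2)\<^sup>2"
proof -
  let ?b = "bernstein_coeff polyP d (0, w1, w2)"
  define p q s where "p = const2 (w1 $ 1)" and "q = const2 (w1 $ 2)" and "s = const2 (w2 $ 2)"
  define t where "t = 1 + X1 + X2"
  obtain A B where expand:
    "homP (p * X1) (q * X1 + s * X2) t = - 12 * p * s ^ 2 * (X1 * X2 ^ 2) + X1 ^ 2 * A + X2 ^ 3 * B"
    unfolding t_def using homP_expand .
  have rep: "bernstein_rep polyP d (0, w1, w2) ?b"
    using bernstein_rep_bernstein_coeff[OF w] d by (simp add: total_degree_polyP)
  \<comment> \<open>The first vertex is the origin, so the point attached to \<open>x\<close> is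
    \<open>y\<close> scaled by \<open>1 / r\<close>. Homogeneity of \<open>homP\<close> absorbs
    \<open>r ^ 4\<close>, and the remaining power of \<open>r\<close> is the degree
    elevation.\<close>
  have "dehomogenized d ?b = t ^ (d - 4) * homP (p * X1) (q * X1 + s * X2) t"
  proof (rule poly2_eqI)
    fix x :: "real ^ 2" assume "x $ 1 > 0" "x $ 2 > 0"
    define r where "r = 1 + x $ 1 + x $ 2"
    define y where "y = x $ 1 *\<^sub>R w1 + x $ 2 *\<^sub>R w2"
    have r: "r \<noteq> 0" using \<open>x $ 1 > 0\<close> \<open>x $ 2 > 0\<close> by (simp add: r_def)
    have "eval2 (dehomogenized d ?b) x = eval2 polyP ((1 / r) *\<^sub>R y) * r ^ d"
      using eval2_bernstein_rep[OF w rep r_def r] by (simp add: y_def)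
    also have "r ^ d = r ^ 4 * r ^ (d - 4)" using d by (simp flip: power_add)
    also have "eval2 polyP ((1 / r) *\<^sub>R y) * (r ^ 4 * r ^ (d - 4)) = r ^ (d - 4) * homP (y $ 1) (y $ 2) r"
      using eval2_polyP_homogeneous[OF r, of y] by (simp add: mult_ac)
    also have "\<dots> = eval2 (t ^ (d - 4) * homP (p * X1) (q * X1 + s * X2) t) x"
      by (simp add: homP_def y_def r_def t_def p_def q_def s_def axis mult.commute)
    finally show "eval2 (dehomogenized d ?b) x = eval2 (t ^ (d - 4) * homP (p * X1) (q * X1 + s * X2) t) x" .
  qed
  also have "\<dots>
    = const2 (- 12 * w1 $ 1 * (w2 $ 2)\<^sup>2) * (X1 ^ 1 * (X2 ^ 2 * t ^ (d - 4)))
      + X1 ^ 2 * (A * t ^ (d - 4)) + X2 ^ 3 * (B * t ^ (d - 4))"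
    unfolding expand by (simp add: p_def s_def algebra_simps power2_eq_square)
  finally have eq: "dehomogenized d ?b = \<dots>" .
  \<comment> \<open>Only the constant term of the elevation factor reaches the monomial
    \<open>X1 * X2 ^ 2\<close>, and it is 1 in every degree.\<close>
  have "coeff (coeff t 0) 0 = 1"
    by (simp add: t_def X1_def X2_def one_pCons)
  then have "coeff (coeff (t ^ (d - 4)) 0) 0 = 1" by (simp add: coeff_0_power)
  then have "coeff (coeff (dehomogenized d ?b) 2) 1 = - 12 * w1 $ 1 * (w2 $ 2)\<^sup>2"
    unfolding eq coeff_add coeff2_const2_mult coeff2_X1_power_mult coeff2_X2_power_mult by simp
  then show ?thesis using d by (simp only: coeff2_dehomogenized[of "d - 3" 1 2 d ?b])
qed

lemma bernstein_coeff_polyP_neg: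
  assumes "affinely_independent (0, w1, w2)" "w2 $ 1 = 0" "w1 $ 1 > 0" "w2 $ 2 > 0" "d \<ge> 4"
  shows "bernstein_coeff polyP d (0, w1, w2) (d - 3, 1, 2) < 0"
proof -
  have "- 12 * w1 $ 1 * (w2 $ 2)\<^sup>2 < 0" using assms(3,4) by simp
  then have "bernstein_coeff polyP d (0, w1, w2) (d - 3, 1, 2) * multinomial (d - 3, 1, 2) < 0"
    by (simp only: bernstein_coeff_polyP[OF assms(1,2,5)])
  then show ?thesis
    using multinomial_pos[of "(d - 3, 1, 2)"] by (simp add: mult_less_0_iff del: multinomial.simps)
qed

lemma bernstein_coeff_polyP_subtriangle:
  fixes \<beta>0 \<beta>1 \<beta>2 \<rho> :: real
  assumes "\<beta>1 > 0" "\<rho> < 1"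
  defines "w \<equiv> (v0, \<beta>0 *\<^sub>R v0 + \<beta>1 *\<^sub>R v1 + \<beta>2 *\<^sub>R v2, \<rho> *\<^sub>R v0 + (1 - \<rho>) *\<^sub>R v2)"
  shows "affinely_independent w" "bernstein_coeff polyP 4 w (1, 1, 2) = - (\<beta>1 * (1 - \<rho>)\<^sup>2)"
proof -
  have v0: "v0 = 0" by (simp add: v0_def vec2_eq_iff)
  show w: "affinely_independent w"
    using assms(1,2) unfolding w_def affinely_independent_iff by (simp add: v0_def v1_def v2_def)
  define w1 w2 where "w1 = \<beta>0 *\<^sub>R v0 + \<beta>1 *\<^sub>R v1 + \<beta>2 *\<^sub>R v2" and "w2 = \<rho> *\<^sub>R v0 + (1 - \<rho>) *\<^sub>R v2"
  have w_eq: "w = (0, w1, w2)" unfolding w_def w1_def w2_def v0 ..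
  have comps: "w1 $ 1 = \<beta>1" "w2 $ 1 = 0" "w2 $ 2 = 1 - \<rho>"
    by (simp_all add: w1_def w2_def v0_def v1_def v2_def)
  \<comment> \<open>This 12 cancels against the 12 in \<open>bernstein_coeff_polyP\<close>.\<close>
  have "multinomial (1, 1, 2) = 12" by (simp add: fact_numeral)
  moreover have "4 - 3 = (1 :: nat)" by simp
  ultimately have "bernstein_coeff polyP 4 (0, w1, w2) (1, 1, 2) * 12 = - 12 * \<beta>1 * (1 - \<rho>)\<^sup>2"
    using bernstein_coeff_polyP[OF w[unfolded w_eq] comps(2), of 4, OF order_refl] unfolding comps by metis
  then show "bernstein_coeff polyP 4 w (1, 1, 2) = - (\<beta>1 * (1 - \<rho>)\<^sup>2)"
    unfolding w_eq by linarith
qed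

section \<open>Consequences for triangulations\<close>

lemma triangulation_negative_coeff:
  assumes \<T>: "triangulates \<T> (simplex_of (v0, v1, v2))"
  shows "\<exists>T\<in>\<T>. \<exists>w. affinely_independent w \<and> T = simplex_of w \<and> bernstein_coeff polyP 4 w (1, 1, 2) < 0"
proof -
  obtain T s where T: "T \<in> \<T>" "T \<subseteq> {x. x $ 1 \<ge> 0 \<and> x $ 2 \<ge> 0}"
    "0 \<in> T" "s > 0" "vector [0, s] \<in> T"
    using triangulation_contains_corner[OF \<T>] .
  obtain w where w: "affinely_independent w" "T = simplex_of w"
    using triangulates_triangle[OF \<T> T(1)] .
  from corner_triangle_reordering[where R = "\<lambda>_. True", OF w TrueI conjI[OF TrueI TrueI] T(2-5)]
  obtain w1 w2 where *: "affinely_independent (0, w1, w2)" "T = simplex_of (0, w1, w2)"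
    "w1 $ 1 > 0" "w2 $ 1 = 0" "w2 $ 2 > 0" by (elim exE conjE) (rule that)
  have "bernstein_coeff polyP 4 (0, w1, w2) (1, 1, 2) < 0"
    using bernstein_coeff_polyP_neg[OF *(1,4,3,5), of 4] by simp
  then show ?thesis
    by (intro bexI[OF _ T(1)] exI[of _ "(0, w1, w2)"] conjI *)
qed

lemma no_nonneg_certificate_on:
  assumes \<T>: "triangulates \<T> (simplex_of (v0, v1, v2))" and deg: "\<forall>T\<in>\<T>. deg T \<ge> 4"
  shows "\<not> nonneg_certificate_on polyP \<T> deg"
proof
  assume cert: "nonneg_certificate_on polyP \<T> deg"
  obtain T s where T: "T \<in> \<T>" "T \<subseteq> {x. x $ 1 \<ge> 0 \<and> x $ 2 \<ge> 0}"
    "0 \<in> T" "s > 0" "vector [0, s] \<in> T"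
    using triangulation_contains_corner[OF \<T>] .
  from cert[unfolded nonneg_certificate_on_def, THEN bspec, OF T(1)]
  obtain w where w: "affinely_independent w" "T = simplex_of w" "nonneg_certificate polyP (deg T) w"
    by (elim exE conjE) (rule that)
  have d: "deg T \<ge> 4" using deg T(1) by blast
  then have degree: "total_degree polyP \<le> deg T" by (simp add: total_degree_polyP)
  have swap: "nonneg_certificate polyP (deg T) (u1, u0, u2) \<and> nonneg_certificate polyP (deg T) (u0, u2, u1)"
    if "affinely_independent (u0, u1, u2)" "nonneg_certificate polyP (deg T) (u0, u1, u2)" for u0 u1 u2
    using nonneg_certificate_swap[OF that(1) degree that(2)] by (rule conjI)
  have "\<exists>w1 w2. affinely_independent (0, w1, w2) \<and> T = simplex_of (0, w1, w2) \<and>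
      nonneg_certificate polyP (deg T) (0, w1, w2) \<and> w1 $ 1 > 0 \<and> w2 $ 1 = 0 \<and> w2 $ 2 > 0"
    \<comment> \<open>The certificate is given for some ordering of the vertices; taking it as
      \<open>R\<close> moves it to the ordering that starts at the origin.\<close>
    by (rule corner_triangle_reordering[where R = "nonneg_certificate polyP (deg T)", OF w _ T(2-5)])
      (rule swap)
  then obtain w1 w2 where *: "affinely_independent (0, w1, w2)" "nonneg_certificate polyP (deg T) (0, w1, w2)"
    "w1 $ 1 > 0" "w2 $ 1 = 0" "w2 $ 2 > 0" by (elim exE conjE) (rule that)
  have "(deg T - 3, 1, 2) \<in> indices (deg T)" using d by (simp add: indices_def)
  then have "bernstein_coeff polyP (deg T) (0, w1, w2) (deg T - 3, 1, 2) \<ge> 0"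
    using *(2) unfolding nonneg_certificate_def by blast
  then show False using bernstein_coeff_polyP_neg[OF *(1,4,3,5) d] by linarith
qed

lemma triangulates_trivial:
  assumes "affinely_independent w"
  shows "triangulates {simplex_of w} (simplex_of w)"
proof -
  have "\<exists>w'. affinely_independent w' \<and> simplex_of w = simplex_of w'"
    using assms by (intro exI[of _ w] conjI refl)
  then show ?thesis by (simp only: triangulates_def) simp
qed

lemma no_nonneg_certificate:
  assumes "d \<ge> 4"
  shows "\<not> nonneg_certificate polyP d (v0, v1, v2)"
proof
  assume "nonneg_certificate polyP d (v0, v1, v2)"
  then have "\<exists>w. affinely_independent w \<and> simplex_of (v0, v1, v2) = simplex_of w \<and> nonneg_certificate polyP d w"
    by (intro exI[of _ "(v0, v1, v2)"] conjI affinely_independent_standard refl)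
  then have "nonneg_certificate_on polyP {simplex_of (v0, v1, v2)} (\<lambda>_. d)"
    by (simp only: nonneg_certificate_on_def ball_simps simp_thms)
  moreover have "\<not> nonneg_certificate_on polyP {simplex_of (v0, v1, v2)} (\<lambda>_. d)"
    using assms by (intro no_nonneg_certificate_on triangulates_trivial affinely_independent_standard ballI)
  ultimately show False by contradiction
qed

text \<open>These properties make \<open>polyP\<close> a counterexample: its zero set in
  \<open>S\<close> lies in \<open>{0}\<close>, and a finite set has no limit points.\<close>

lemma polyP_isolated_zero:
  "polyP \<noteq> 0" "\<forall>x\<in>S. eval2 polyP x \<ge> 0" "discrete {x \<in> S. eval2 polyP x = 0}"
proof -
  have zero_iff: "eval2 polyP x = 0 \<longleftrightarrow> x = 0" for x
    using eval2_polyP_pos[of x] eval2_polyP_0 by (cases "x = 0") simp_all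
  show "polyP \<noteq> 0"
  proof
    assume "polyP = 0"
    then have "eval2 polyP 1 = 0" by simp
    then show False by (simp add: zero_iff)
  qed
  show "\<forall>x\<in>S. eval2 polyP x \<ge> 0"
  proof
    fix x
    show "eval2 polyP x \<ge> 0"
      using eval2_polyP_pos[of x] eval2_polyP_0 by (cases "x = 0") simp_all
  qed
  have "{x \<in> S. eval2 polyP x = 0} \<subseteq> {0}" by (auto simp: zero_iff)
  then have "finite {x \<in> S. eval2 polyP x = 0}" by (rule finite_subset) simp
  then show "discrete {x \<in> S. eval2 polyP x = 0}"
    unfolding discrete_def isolated_in_islimpt_iff using islimpt_finite by blast
qed

theorem mainTheorem1:
  shows
    "(polyP = (\<Sum>i\<in>UNIV. monomials $ i * (map_matrix const2 M\<^sub>P *v monomials) $ i))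
    \<and> (positive_definite M\<^sub>P)
    \<and> (\<exists>qs :: poly2 list. polyP = (\<Sum>q\<leftarrow>qs. q ^ 2))
    \<and> (eval2 polyP 0 = 0)
    \<and> (\<forall>x. x \<noteq> 0 \<longrightarrow> eval2 polyP x > 0)
    \<and> (\<forall>\<alpha>\<in>indices 4. bernstein_coeff polyP 4 (v0, v1, v2) \<alpha> =
       (if \<alpha> = (2, 2, 0) then 3 else if \<alpha> = (1, 2, 1) then 1
        else if \<alpha> = (1, 1, 2) then -1 else if \<alpha> = (0, 4, 0) then 3
        else if \<alpha> = (0, 0, 4) then 30 else 0))
    \<and> (\<forall>(\<beta>0 :: real) (\<beta>1 :: real) (\<beta>2 :: real) (\<rho> :: real).
       \<beta>0 \<ge> 0 \<and> \<beta>1 \<ge> 0 \<and> \<beta>2 \<ge> 0 \<and> \<beta>0 + \<beta>1 + \<beta>2 = 1 \<and> \<beta>1 > 0 \<and> 0 \<le> \<rho> \<and> \<rho> < 1 \<longrightarrow>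
       (let w = (v0, \<beta>0 *\<^sub>R v0 + \<beta>1 *\<^sub>R v1 + \<beta>2 *\<^sub>R v2, \<rho> *\<^sub>R v0 + (1 - \<rho>) *\<^sub>R v2) in
          affinely_independent w \<and>
          bernstein_coeff polyP 4 w (1, 1, 2)
            = \<beta>1 * (1 - \<rho>)\<^sup>2 * bernstein_coeff polyP 4 (v0, v1, v2) (1, 1, 2) \<and>
          \<beta>1 * (1 - \<rho>)\<^sup>2 * bernstein_coeff polyP 4 (v0, v1, v2) (1, 1, 2)
            = - (\<beta>1 * (1 - \<rho>)\<^sup>2) \<and>
          - (\<beta>1 * (1 - \<rho>)\<^sup>2) < 0))
    \<and> (\<forall>\<T>. triangulates \<T> (simplex_of (v0, v1, v2)) \<longrightarrow>
       (\<exists>T\<in>\<T>. \<exists>w. affinely_independent w \<and> T = simplex_of w \<and>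
          bernstein_coeff polyP 4 w (1, 1, 2) < 0))
    \<and> (triangulates {simplex_of (v0, v1, v2)} (simplex_of (v0, v1, v2)))
    \<and> (\<not> (\<exists>\<T> deg. triangulates \<T> (simplex_of (v0, v1, v2)) \<and>
          (\<forall>T\<in>\<T>. deg T \<ge> 4) \<and> nonneg_certificate_on polyP \<T> deg))
    \<and> (\<not> (\<forall>Q w. Q \<noteq> 0 \<and> affinely_independent w \<and>
          (\<forall>x\<in>simplex_of w. eval2 Q x \<ge> 0) \<and>
          discrete {x \<in> simplex_of w. eval2 Q x = 0} \<longrightarrow>
          (\<exists>d\<ge>total_degree Q. nonneg_certificate Q d w)))
    \<and> (\<not> (\<forall>Q w. Q \<noteq> 0 \<and> affinely_independent w \<and>
          (\<forall>x\<in>simplex_of w. eval2 Q x \<ge> 0) \<and>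
          discrete {x \<in> simplex_of w. eval2 Q x = 0} \<longrightarrow>
          (\<exists>\<T> deg. triangulates \<T> (simplex_of w) \<and>
             (\<forall>T\<in>\<T>. deg T \<ge> total_degree Q) \<and> nonneg_certificate_on Q \<T> deg)))"
proof (intro conjI)
  show "\<exists>qs :: poly2 list. polyP = (\<Sum>q\<leftarrow>qs. q ^ 2)"
  proof
    let ?f = "3 * X1 - 3 * X1 ^ 2 - 2 * (X1 * X2) - X2 ^ 2" and ?g = "X1 ^ 2 - 2 * X2 ^ 2"
    \<comment> \<open>The weights 2 and 3 become repetitions, 9 is absorbed as the square of 3, and
      12 is split as 9 + 1 + 1 + 1.\<close>
    let ?qs = "[?f, ?f, ?g, ?g, ?g, X1 * X2 + 2 * X2 ^ 2, 3 * X1 * X2,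
      3 * X2 ^ 2, X2 ^ 2, X2 ^ 2, X2 ^ 2]"
    show "polyP = (\<Sum>q\<leftarrow>?qs. q ^ 2)"
      unfolding polyP_eq_homP homP_sum_of_squares by (simp add: power_mult_distrib)
  qed
  show "\<forall>(\<beta>0 :: real) (\<beta>1 :: real) (\<beta>2 :: real) (\<rho> :: real).
       \<beta>0 \<ge> 0 \<and> \<beta>1 \<ge> 0 \<and> \<beta>2 \<ge> 0 \<and> \<beta>0 + \<beta>1 + \<beta>2 = 1 \<and> \<beta>1 > 0 \<and> 0 \<le> \<rho> \<and> \<rho> < 1 \<longrightarrow>
       (let w = (v0, \<beta>0 *\<^sub>R v0 + \<beta>1 *\<^sub>R v1 + \<beta>2 *\<^sub>R v2, \<rho> *\<^sub>R v0 + (1 - \<rho>) *\<^sub>R v2) in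
          affinely_independent w \<and>
          bernstein_coeff polyP 4 w (1, 1, 2)
            = \<beta>1 * (1 - \<rho>)\<^sup>2 * bernstein_coeff polyP 4 (v0, v1, v2) (1, 1, 2) \<and>
          \<beta>1 * (1 - \<rho>)\<^sup>2 * bernstein_coeff polyP 4 (v0, v1, v2) (1, 1, 2)
            = - (\<beta>1 * (1 - \<rho>)\<^sup>2) \<and>
          - (\<beta>1 * (1 - \<rho>)\<^sup>2) < 0)"
    unfolding Let_def
    using bernstein_coeff_polyP_subtriangle bernstein_coeff_standard[of "(1, 1, 2)"]
    by (simp add: indices_def del: affinely_independent.simps)
  let ?w = "(v0, v1, v2)"
  have counterexample: "polyP \<noteq> 0 \<and> affinely_independent ?w \<and> (\<forall>x\<in>simplex_of ?w. eval2 polyP x \<ge> 0) \<and>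
      discrete {x \<in> simplex_of ?w. eval2 polyP x = 0}"
    using polyP_isolated_zero affinely_independent_standard by blast
  show "\<not> (\<exists>\<T> deg. triangulates \<T> (simplex_of ?w) \<and>
          (\<forall>T\<in>\<T>. deg T \<ge> 4) \<and> nonneg_certificate_on polyP \<T> deg)"
    using no_nonneg_certificate_on by blast
  show "\<not> (\<forall>Q w. Q \<noteq> 0 \<and> affinely_independent w \<and>
          (\<forall>x\<in>simplex_of w. eval2 Q x \<ge> 0) \<and>
          discrete {x \<in> simplex_of w. eval2 Q x = 0} \<longrightarrow>
          (\<exists>d\<ge>total_degree Q. nonneg_certificate Q d w))"
  proof
    assume "\<forall>Q w. Q \<noteq> 0 \<and> affinely_independent w \<and>
          (\<forall>x\<in>simplex_of w. eval2 Q x \<ge> 0) \<and>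
          discrete {x \<in> simplex_of w. eval2 Q x = 0} \<longrightarrow>
          (\<exists>d\<ge>total_degree Q. nonneg_certificate Q d w)"
    from this[rule_format, OF counterexample] show False
      using no_nonneg_certificate by (auto simp: total_degree_polyP)
  qed
  show "\<not> (\<forall>Q w. Q \<noteq> 0 \<and> affinely_independent w \<and>
          (\<forall>x\<in>simplex_of w. eval2 Q x \<ge> 0) \<and>
          discrete {x \<in> simplex_of w. eval2 Q x = 0} \<longrightarrow>
          (\<exists>\<T> deg. triangulates \<T> (simplex_of w) \<and>
             (\<forall>T\<in>\<T>. deg T \<ge> total_degree Q) \<and> nonneg_certificate_on Q \<T> deg))"
  proof
    assume "\<forall>Q w. Q \<noteq> 0 \<and> affinely_independent w \<and>
          (\<forall>x\<in>simplex_of w. eval2 Q x \<ge> 0) \<and>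
          discrete {x \<in> simplex_of w. eval2 Q x = 0} \<longrightarrow>
          (\<exists>\<T> deg. triangulates \<T> (simplex_of w) \<and>
             (\<forall>T\<in>\<T>. deg T \<ge> total_degree Q) \<and> nonneg_certificate_on Q \<T> deg)"
    from this[rule_format, OF counterexample] show False
      using no_nonneg_certificate_on unfolding total_degree_polyP by blast
  qed
  show "\<forall>\<alpha>\<in>indices 4. bernstein_coeff polyP 4 ?w \<alpha> =
       (if \<alpha> = (2, 2, 0) then 3 else if \<alpha> = (1, 2, 1) then 1
        else if \<alpha> = (1, 1, 2) then -1 else if \<alpha> = (0, 4, 0) then 3
        else if \<alpha> = (0, 0, 4) then 30 else 0)"
    by (rule ballI) (rule bernstein_coeff_standard)
  show "triangulates {simplex_of ?w} (simplex_of ?w)"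
    by (rule triangulates_trivial[OF affinely_independent_standard])
  show "\<forall>\<T>. triangulates \<T> (simplex_of ?w) \<longrightarrow>
       (\<exists>T\<in>\<T>. \<exists>w. affinely_independent w \<and> T = simplex_of w \<and>
          bernstein_coeff polyP 4 w (1, 1, 2) < 0)"
    by (intro allI impI triangulation_negative_coeff)
  show "\<forall>x. x \<noteq> 0 \<longrightarrow> eval2 polyP x > 0"
    using eval2_polyP_pos by blast
qed (rule polyP_eq_Gram positive_definite_Gram eval2_polyP_0)+

end
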